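(* Let $p$ be a positive integer, $X$ an $n$-dimensional complex manifold on which one can define a global $\mathcal{C}^2$-smooth real valued function whose complex Hessian has at each point at least $n-p+1$ positive eigenvalues, and $A$ a nonempty compact subset of $X$. Let $\Psi_p(A)$ be the set of points at which $A$ is set-theoretically $p$-pseudoconvex. Then $\Psi_p(A)\ne\emptyset$ and, for every $x\in A$, $$|u(x)|\le\sup_{\Psi_p(A)}|u|\qquad\text{for all } u\in\tilde{\mathscr{O}}_A\big(A\setminus\overline{\Psi_p(A)}\big)\cap\mathcal{C}^0(A).$$
   Context: The notation $u\in\tilde{\mathscr{O}}_A(V)\cap\mathcal{C}^0(A)$ means that $u$ is continuous on $A$ and its restriction to $V$ belongs to $\tilde{\mathscr{O}}_A(V)$. Pseudoconvexity. Let $X$ be an $n$-dimensional complex manifold, $A\subseteq X$ locally closed, $x\in A$. $A$ is set-theoretically $p$-pseudoconvex at $x$ if there are an open neighbourhood $\omega$ of $x$ in $X$ and $\rho\in\mathcal{C}^\infty(\omega,\mathbb{R})$ such that $A\cap\omega\subseteq\{\rho\le\rho(x)\}$ and the complex Hessian $(\partial^2\rho/\partial z_i\partial\bar z_j)$ at $x$ has at least $n-p+1$ positive eigenvalues. LACR functions. $\mathcal{C}_A$ is the sheaf of germs of continuous complex valued functions on $A$. $\mathscr{O}_A\subseteq\mathcal{C}_A$ is the subsheaf of germs of functions that are, near each point, restrictions to $A$ of holomorphic functions on open subsets of $X$. For a set $\mathcal{H}$ of germs of continuous functions on $A$ and $U$ open in $A$, $\mathcal{H}(U)$ is the set of continuous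 functions on $U$ all of whose germs belong to $\mathcal{H}$; $\mathcal{H}^c$ is the set of germs $f_{(x)}$ having, on some open neighbourhood $U_x$ of $x$ in $A$, a representative which is the limit, uniformly on compact subsets of $U_x$, of a sequence in $\mathcal{H}(U_x)$. $\mathcal{H}^{(c)}$ is the smallest set of germs that contains $\mathcal{H}$ and is stable under $\mathcal{H}\mapsto\mathcal{H}^c$. The sheaf of LACR (locally approximable continuous CR) functions is $\tilde{\mathscr{O}}_A=\mathscr{O}_A^{(c)}$. *)

theory Defs
  imports "HOL-Analysis.Analysis"
begin

section \<open>Several complex variables on open subsets of \<open>\<complex>\<^sup>n\<close>\<close>

definition holo_on :: "(complex^'n \<Rightarrow> complex) \<Rightarrow> (complex^'n) set \<Rightarrow> bool" where
  "holo_on f S \<longleftrightarrow>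
     (\<forall>z\<in>S. \<exists>D. (f has_derivative D) (at z) \<and> (\<forall>c v. D (c *s v) = c * D v))"

definition holo_map_on :: "(complex^'n \<Rightarrow> complex^'m) \<Rightarrow> (complex^'n) set \<Rightarrow> bool" where
  "holo_map_on f S \<longleftrightarrow> (\<forall>i. holo_on (\<lambda>z. f z $ i) S)"

text \<open>Real \<open>C\<^sup>k\<close> smoothness; only meaningful for open \<open>S\<close>.\<close>

primrec Ck_on :: "nat \<Rightarrow> ('a::real_normed_vector \<Rightarrow> 'b::real_normed_vector) \<Rightarrow> 'a set \<Rightarrow> bool" where
  "Ck_on 0 f S \<longleftrightarrow> continuous_on S f"
| "Ck_on (Suc k) f S \<longleftrightarrow>
     (\<forall>x\<in>S. f differentiable (at x)) \<and> (\<forall>v. Ck_on k (\<lambda>x. frechet_derivative f (at x) v) S)"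

text \<open>The Wirtinger operators \<open>\<partial>/\<partial>z\<^sub>i = (\<partial>/\<partial>x\<^sub>i - \<i> \<partial>/\<partial>y\<^sub>i)/2\<close> and
  \<open>\<partial>/\<partial>\<bar>z\<^sub>j = (\<partial>/\<partial>x\<^sub>j + \<i> \<partial>/\<partial>y\<^sub>j)/2\<close>, where \<open>\<partial>/\<partial>x\<^sub>i\<close> and \<open>\<partial>/\<partial>y\<^sub>i\<close>
  are the derivatives in the directions \<open>axis i 1\<close> and \<open>axis i \<i>\<close>.\<close>

definition d_z :: "'n \<Rightarrow> (complex^'n \<Rightarrow> complex) \<Rightarrow> complex^'n \<Rightarrow> complex" where
  "d_z i f z =
     (frechet_derivative f (at z) (axis i 1) - \<i> * frechet_derivative f (at z) (axis i \<i>)) / 2"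

definition d_zbar :: "'n \<Rightarrow> (complex^'n \<Rightarrow> complex) \<Rightarrow> complex^'n \<Rightarrow> complex" where
  "d_zbar j f z =
     (frechet_derivative f (at z) (axis j 1) + \<i> * frechet_derivative f (at z) (axis j \<i>)) / 2"

definition complex_hessian :: "(complex^'n \<Rightarrow> real) \<Rightarrow> complex^'n \<Rightarrow> complex^'n^'n" where
  "complex_hessian f z = (\<chi> i j. d_z i (d_zbar j (\<lambda>w. complex_of_real (f w))) z)"

text \<open>The number of positive eigenvalues counted with multiplicity, the multiplicity of an
  eigenvalue being the dimension of its eigenspace; this is only used for Hermitian matrices,
  where it equals the multiplicity as a root of the characteristic polynomial.\<close>

definition eigenspace :: "complex^'n^'n \<Rightarrow> complex \<Rightarrow> (complex^'n) set" where
  "eigenspace H l = {v. H *v v = l *s v}"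

definition num_pos_eigenvalues :: "complex^'n^'n \<Rightarrow> nat" where
  "num_pos_eigenvalues H =
     (\<Sum>r\<in>{r::real. 0 < r \<and> (\<exists>v\<in>eigenspace H (of_real r). v \<noteq> 0)}.
        vec.dim (eigenspace H (of_real r)))"


section \<open>Complex manifolds\<close>

text \<open>The underlying space of a manifold \<open>X\<close> is a whole type; its dimension is \<open>CARD('n)\<close>.
  An atlas is a set of pairs \<open>(U, \<phi>)\<close>, and \<open>inv_into U \<phi>\<close> is the inverse of the chart \<open>\<phi>\<close> on \<open>\<phi> ` U\<close>.
  Neither connectedness nor second countability is required.\<close>

type_synonym ('x, 'n) chart = "'x set \<times> ('x \<Rightarrow> complex^'n)"

definition complex_atlas :: "('x::t2_space, 'n::finite) chart set \<Rightarrow> bool" where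
  "complex_atlas X \<longleftrightarrow>
     (\<Union>(U, \<phi>)\<in>X. U) = UNIV \<and>
     (\<forall>(U, \<phi>)\<in>X. open U \<and> open (\<phi> ` U) \<and> homeomorphism U (\<phi> ` U) \<phi> (inv_into U \<phi>)) \<and>
     (\<forall>(U, \<phi>)\<in>X. \<forall>(V, \<psi>)\<in>X. holo_map_on (\<psi> \<circ> inv_into U \<phi>) (\<phi> ` (U \<inter> V)))"

definition mfd_holo_on ::
  "('x::t2_space, 'n::finite) chart set \<Rightarrow> ('x \<Rightarrow> complex) \<Rightarrow> 'x set \<Rightarrow> bool" where
  "mfd_holo_on X f W \<longleftrightarrow> (\<forall>(U, \<phi>)\<in>X. holo_on (f \<circ> inv_into U \<phi>) (\<phi> ` (U \<inter> W)))"

definition mfd_Ck_on ::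
  "('x::t2_space, 'n::finite) chart set \<Rightarrow> nat \<Rightarrow> ('x \<Rightarrow> real) \<Rightarrow> 'x set \<Rightarrow> bool" where
  "mfd_Ck_on X k f W \<longleftrightarrow> (\<forall>(U, \<phi>)\<in>X. Ck_on k (f \<circ> inv_into U \<phi>) (\<phi> ` (U \<inter> W)))"

definition mfd_smooth_on ::
  "('x::t2_space, 'n::finite) chart set \<Rightarrow> ('x \<Rightarrow> real) \<Rightarrow> 'x set \<Rightarrow> bool" where
  "mfd_smooth_on X f W \<longleftrightarrow> (\<forall>k. mfd_Ck_on X k f W)"

text \<open>The complex Hessian of \<open>f\<close> at \<open>x\<close> has at least \<open>m\<close> positive eigenvalues. For a function that is
  \<open>C\<^sup>2\<close> near \<open>x\<close>, a holomorphic change of coordinates replaces the Hessian by a congruent matrix, so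
  the number of positive eigenvalues is the same in all charts around \<open>x\<close>.\<close>

definition hessian_pos_ge ::
  "('x::t2_space, 'n::finite) chart set \<Rightarrow> nat \<Rightarrow> ('x \<Rightarrow> real) \<Rightarrow> 'x \<Rightarrow> bool" where
  "hessian_pos_ge X m f x \<longleftrightarrow>
     (\<exists>(U, \<phi>)\<in>X. x \<in> U \<and>
        m \<le> num_pos_eigenvalues (complex_hessian (f \<circ> inv_into U \<phi>) (\<phi> x)))"


section \<open>Set-theoretic pseudoconvexity\<close>

text \<open>For \<open>p > n\<close> the truncated difference \<open>n + 1 - p\<close> is \<open>0\<close>; in that case the condition on the
  number of positive eigenvalues is void, just as with the integer \<open>n - p + 1 \<le> 0\<close>.\<close>

definition pseudoconvex_at ::
  "('x::t2_space, 'n::finite) chart set \<Rightarrow> nat \<Rightarrow> 'x set \<Rightarrow> 'x \<Rightarrow> bool" where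
  "pseudoconvex_at X p A x \<longleftrightarrow>
     (\<exists>\<omega> \<rho>. open \<omega> \<and> x \<in> \<omega> \<and> mfd_smooth_on X \<rho> \<omega> \<and>
        A \<inter> \<omega> \<subseteq> {y. \<rho> y \<le> \<rho> x} \<and>
        hessian_pos_ge X (CARD('n) + 1 - p) \<rho> x)"

definition Psi :: "('x::t2_space, 'n::finite) chart set \<Rightarrow> nat \<Rightarrow> 'x set \<Rightarrow> 'x set" where
  "Psi X p A = {x\<in>A. pseudoconvex_at X p A x}"


section \<open>Germs on \<open>A\<close> and LACR functions\<close>

text \<open>A germ on \<open>A\<close> is a base point together with the class of all functions that agree with a given
  one on a neighbourhood of that point in \<open>A\<close>. Functions are total; their values away from the
  neighbourhood in question, in particular off \<open>A\<close>, are irrelevant.\<close>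

type_synonym 'x germ = "'x \<times> ('x \<Rightarrow> complex) set"

definition germ :: "'x::topological_space set \<Rightarrow> 'x \<Rightarrow> ('x \<Rightarrow> complex) \<Rightarrow> 'x germ" where
  "germ A x f =
     (x, {g. \<exists>U. openin (top_of_set A) U \<and> x \<in> U \<and> (\<forall>y\<in>U. g y = f y)})"

definition cont_germs :: "'x::topological_space set \<Rightarrow> 'x germ set" where
  "cont_germs A =
     {germ A x f | x f. \<exists>U. openin (top_of_set A) U \<and> x \<in> U \<and> continuous_on U f}"

definition holo_germs ::
  "('x::t2_space, 'n::finite) chart set \<Rightarrow> 'x set \<Rightarrow> 'x germ set" where
  "holo_germs X A = {germ A x F | x F. x \<in> A \<and> (\<exists>W. open W \<and> x \<in> W \<and> mfd_holo_on X F W)}"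

text \<open>\<open>sections A H U\<close> is the set \<open>H(U)\<close>, for \<open>U\<close> open in \<open>A\<close>.\<close>

definition sections ::
  "'x::topological_space set \<Rightarrow> 'x germ set \<Rightarrow> 'x set \<Rightarrow> ('x \<Rightarrow> complex) set" where
  "sections A H U = {f. continuous_on U f \<and> (\<forall>x\<in>U. germ A x f \<in> H)}"

definition germ_limits :: "'x::topological_space set \<Rightarrow> 'x germ set \<Rightarrow> 'x germ set" where
  "germ_limits A H =
     {germ A x f | x f. \<exists>U s. openin (top_of_set A) U \<and> x \<in> U \<and> continuous_on U f \<and>
        (\<forall>k::nat. s k \<in> sections A H U) \<and>
        (\<forall>K. compact K \<and> K \<subseteq> U \<longrightarrow> uniform_limit K s f sequentially)}"

definition germ_closure :: "'x::topological_space set \<Rightarrow> 'x germ set \<Rightarrow> 'x germ set" where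
  "germ_closure A H = \<Inter>{S. S \<subseteq> cont_germs A \<and> H \<subseteq> S \<and> germ_limits A S \<subseteq> S}"

definition lacr_germs ::
  "('x::t2_space, 'n::finite) chart set \<Rightarrow> 'x set \<Rightarrow> 'x germ set" where
  "lacr_germs X A = germ_closure A (holo_germs X A)"

end

theory Submission
  imports Defs "HOL-Complex_Analysis.Cauchy_Integral_Formula"
begin

text \<open>
  If \<open>f\<close> is a function with at least \<open>m = n - p + 1\<close> positive Hessian eigenvalues and \<open>f|A\<close> has a
  maximum at \<open>x\<close>, then the second-order Taylor polynomial of \<open>f\<close> at \<open>x\<close> minus \<open>\<delta> |z - x|\<^sup>2\<close> is a smooth
  witness for the pseudoconvexity of \<open>A\<close> at \<open>x\<close>. This proves \<open>\<Psi>\<^sub>p(A) \<noteq> {}\<close>. For the maximum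
  principle, call a germ \<open>u\<close> at \<open>x\<close> good if \<open>u(x) = 0\<close>, or \<open>x\<close> lies in the closure of \<open>\<Psi>\<^sub>p(A)\<close>, or no
  function \<open>|u| e\<^bsup>s T\<^esup>\<close>, with \<open>s > 0\<close> and \<open>T\<close> having \<open>m\<close> positive Hessian eigenvalues, has a local
  maximum on \<open>A\<close> at \<open>x\<close>. Holomorphic germs are good because \<open>ln |u|\<close> is pluriharmonic, and goodness
  survives locally uniform limits, because a maximum made strict is approximated by maxima of the
  approximants. So all LACR germs are good. If \<open>|u(x)|\<close> exceeded the supremum over \<open>\<Psi>\<^sub>p(A)\<close>, then for
  small \<open>\<epsilon>\<close> the maximum over \<open>A\<close> of \<open>|u| e\<^bsup>\<epsilon> f\<^esup>\<close> would be attained off the closure of \<open>\<Psi>\<^sub>p(A)\<close>.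
\<close>

section \<open>Functions of class \<open>C\<^sup>k\<close>\<close>

lemma frechet_derivative_eqI:
  "(f has_derivative D) (at x) \<Longrightarrow> frechet_derivative f (at x) = D"
  by (metis frechet_derivative_at)

lemma frechet_has_derivative:
  "f differentiable (at x) \<Longrightarrow> (f has_derivative frechet_derivative f (at x)) (at x)"
  by (simp add: frechet_derivative_works)

lemma frechet_derivative_cong_open:
  assumes "open S" "x \<in> S" "\<And>y. y \<in> S \<Longrightarrow> f y = g y"
  shows "frechet_derivative f (at x) = frechet_derivative g (at x)"
proof -
  have "(f has_derivative D) (at x) \<longleftrightarrow> (g has_derivative D) (at x)" for D
    using has_derivative_transform_within_open[OF _ assms(1,2)] assms(3) by metis
  then show ?thesis unfolding frechet_derivative_def by simp
qed

lemma differentiable_cong_open: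
  assumes "open S" "x \<in> S" "\<And>y. y \<in> S \<Longrightarrow> f y = g y"
  shows "f differentiable (at x) \<longleftrightarrow> g differentiable (at x)"
  unfolding differentiable_def
  using has_derivative_transform_within_open[OF _ assms(1,2)] assms(3) by metis

lemma Ck_on_cong:
  assumes "open S" "\<And>x. x \<in> S \<Longrightarrow> f x = g x"
  shows "Ck_on k f S \<longleftrightarrow> Ck_on k g S"
  using assms(2)
proof (induction k arbitrary: f g)
  case 0
  then show ?case by (simp cong: continuous_on_cong)
next
  case (Suc k)
  have "Ck_on k (\<lambda>x. frechet_derivative f (at x) v) S
      \<longleftrightarrow> Ck_on k (\<lambda>x. frechet_derivative g (at x) v) S" for v
    by (rule Suc.IH) (simp add: frechet_derivative_cong_open[OF assms(1) _ Suc.prems])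
  then show ?case
    using differentiable_cong_open[OF assms(1) _ Suc.prems] by simp
qed

lemma Ck_on_subset: "Ck_on k f S \<Longrightarrow> T \<subseteq> S \<Longrightarrow> Ck_on k f T"
  by (induction k arbitrary: f) (auto intro: continuous_on_subset)

lemma Ck_on_imp_continuous_on: "Ck_on k f S \<Longrightarrow> continuous_on S f"
  by (cases k)
     (auto intro!: continuous_at_imp_continuous_on differentiable_imp_continuous_within)

lemma Ck_on_SucD: "Ck_on (Suc k) f S \<Longrightarrow> Ck_on k f S"
proof (induction k arbitrary: f)
  case 0
  then show ?case using Ck_on_imp_continuous_on[OF "0"] by simp
next
  case (Suc k)
  then show ?case by auto
qed

lemma Ck_on_const: "Ck_on k (\<lambda>_. c) S"
  by (induction k arbitrary: c) auto

text \<open>Lets an explicit formula for the derivative replace \<open>frechet_derivative\<close>,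
  which is only a choice term; openness of \<open>S\<close> makes the two interchangeable inside a
  further derivative.\<close>

lemma Ck_on_SucI:
  assumes "\<And>x. x \<in> S \<Longrightarrow> (f has_derivative D x) (at x)"
    and "open S" and "\<And>v. Ck_on k (\<lambda>x. D x v) S"
  shows "Ck_on (Suc k) f S"
proof -
  have "Ck_on k (\<lambda>x. frechet_derivative f (at x) v) S" for v
    by (rule iffD2[OF Ck_on_cong[OF assms(2)] assms(3)[of v]])
       (simp add: frechet_derivative_eqI[OF assms(1)])
  then show ?thesis using assms(1) by (auto simp: differentiable_def)
qed

lemma Ck_on_add:
  assumes "open S" "Ck_on k f S" "Ck_on k g S"
  shows "Ck_on k (\<lambda>x. f x + g x) S"
  using assms(2,3)
proof (induction k arbitrary: f g)
  case 0
  then show ?case by (auto intro: continuous_intros)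
next
  case (Suc k)
  show ?case
    by (rule Ck_on_SucI[where D = "\<lambda>x v. frechet_derivative f (at x) v
          + frechet_derivative g (at x) v", OF _ assms(1)])
       (use Suc in \<open>auto intro!: has_derivative_add frechet_has_derivative Suc.IH\<close>)
qed

lemma Ck_on_bounded_linear:
  assumes "bounded_linear L" "open S" "Ck_on k f S"
  shows "Ck_on k (\<lambda>x. L (f x)) S"
  using assms(3)
proof (induction k arbitrary: f)
  case 0
  then show ?case by (auto intro: bounded_linear.continuous_on[OF assms(1)])
next
  case (Suc k)
  show ?case
    by (rule Ck_on_SucI[OF _ assms(2)])
       (use Suc in \<open>auto intro!: bounded_linear.has_derivative[OF assms(1)] frechet_has_derivative\<close>)
qed

text \<open>Leibniz rule. In each summand one factor stays undifferentiated, so its class must first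
  be lowered from \<open>Suc k\<close> to \<open>k\<close> before the induction hypothesis
  applies.\<close>

lemma Ck_on_bounded_bilinear:
  assumes "bounded_bilinear B" "open S" "Ck_on k f S" "Ck_on k g S"
  shows "Ck_on k (\<lambda>x. B (f x) (g x)) S"
  using assms(3,4)
proof (induction k arbitrary: f g)
  case 0
  then show ?case by (auto intro: bounded_bilinear.continuous_on[OF assms(1)])
next
  case (Suc k)
  show ?case
    by (rule Ck_on_SucI[where D = "\<lambda>x v. B (f x) (frechet_derivative g (at x) v)
          + B (frechet_derivative f (at x) v) (g x)", OF _ assms(2)])
       (use Suc in \<open>auto intro!: bounded_bilinear.FDERIV[OF assms(1)] frechet_has_derivative
          Ck_on_add[OF assms(2)] Suc.IH Ck_on_SucD[OF Suc.prems(1)] Ck_on_SucD[OF Suc.prems(2)]\<close>)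
qed

lemma Ck_on_id: "open S \<Longrightarrow> Ck_on k (\<lambda>x. x) S"
proof (cases k)
  case (Suc j)
  assume "open S"
  then show ?thesis unfolding Suc
    by (intro Ck_on_SucI[where D = "\<lambda>_ v. v"] Ck_on_const) auto
qed (simp add: continuous_on_id)

section \<open>Second derivatives: bilinearity, Taylor expansion, symmetry\<close>

definition snd_deriv :: "('a::real_normed_vector \<Rightarrow> 'b::real_normed_vector) \<Rightarrow> 'a \<Rightarrow> 'a \<Rightarrow> 'a \<Rightarrow> 'b"
  where "snd_deriv f z v w = frechet_derivative (\<lambda>x. frechet_derivative f (at x) v) (at z) w"

lemma C2_on_has_derivative:
  assumes "Ck_on 2 f S" "z \<in> S"
  shows "(f has_derivative frechet_derivative f (at z)) (at z)"
  using assms by (auto simp: numeral_2_eq_2 intro!: frechet_has_derivative)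

lemma C2_on_has_snd_deriv:
  assumes "Ck_on 2 f S" "z \<in> S"
  shows "((\<lambda>x. frechet_derivative f (at x) v) has_derivative snd_deriv f z v) (at z)"
proof -
  have "(\<lambda>x. frechet_derivative f (at x) v) differentiable (at z)"
    using assms by (auto simp: numeral_2_eq_2)
  then show ?thesis using frechet_has_derivative unfolding snd_deriv_def by blast
qed

lemma snd_deriv_eqI:
  assumes "open S" "z \<in> S" "\<And>x. x \<in> S \<Longrightarrow> (f has_derivative D x) (at x)"
    and "((\<lambda>x. D x v) has_derivative B) (at z)"
  shows "snd_deriv f z v w = B w"
proof -
  have "frechet_derivative (\<lambda>x. frechet_derivative f (at x) v) (at z)
      = frechet_derivative (\<lambda>x. D x v) (at z)"
    by (rule frechet_derivative_cong_open[OF assms(1,2)])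
       (simp add: frechet_derivative_eqI[OF assms(3)])
  then show ?thesis unfolding snd_deriv_def using frechet_derivative_eqI[OF assms(4)] by simp
qed

lemma snd_deriv_cong_open:
  assumes "open S" "z \<in> S" "\<And>x. x \<in> S \<Longrightarrow> f x = g x"
  shows "snd_deriv f z v w = snd_deriv g z v w"
proof -
  have "frechet_derivative (\<lambda>x. frechet_derivative f (at x) v) (at z)
      = frechet_derivative (\<lambda>x. frechet_derivative g (at x) v) (at z)"
    by (rule frechet_derivative_cong_open[OF assms(1,2)])
       (simp add: frechet_derivative_cong_open[OF assms(1) _ assms(3)])
  then show ?thesis unfolding snd_deriv_def by simp
qed

text \<open>Linearity in the second slot is that of a derivative. Linearity in the first comes from
  differentiating at \<open>z\<close> the linearity identities of the first derivative, valid at all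
  points of \<open>S\<close>. Boundedness is automatic in finite dimension.\<close>

lemma snd_deriv_bounded_bilinear:
  fixes f :: "'a::euclidean_space \<Rightarrow> 'b::euclidean_space"
  assumes "Ck_on 2 f S" "open S" "z \<in> S"
  shows "bounded_bilinear (snd_deriv f z)"
proof -
  have "linear (\<lambda>w. snd_deriv f z v w)" for v
    unfolding snd_deriv_def
    by (rule linear_frechet_derivative) (use assms in \<open>simp add: numeral_2_eq_2\<close>)
  moreover have "snd_deriv f z (u + v) w = snd_deriv f z u w + snd_deriv f z v w"
    and "snd_deriv f z (c *\<^sub>R v) w = c *\<^sub>R snd_deriv f z v w" for u v w c
  proof -
    have D: "(f has_derivative frechet_derivative f (at x)) (at x)" if "x \<in> S" for x
      by (rule C2_on_has_derivative[OF assms(1) that])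
    have lin: "linear (frechet_derivative f (at x))" if "x \<in> S" for x
      using D[OF that] has_derivative_linear by blast
    have D2: "((\<lambda>x. frechet_derivative f (at x) v) has_derivative snd_deriv f z v) (at z)" for v
      by (rule C2_on_has_snd_deriv[OF assms(1,3)])
    have *: "((\<lambda>x. frechet_derivative f (at x) (u + v)) has_derivative
        (\<lambda>w. snd_deriv f z u w + snd_deriv f z v w)) (at z)"
      by (rule has_derivative_transform_within_open[OF has_derivative_add[OF D2 D2] assms(2,3)])
         (simp add: linear_add[OF lin])
    show "snd_deriv f z (u + v) w = snd_deriv f z u w + snd_deriv f z v w"
      by (rule snd_deriv_eqI[where D = "\<lambda>x. frechet_derivative f (at x)" and v = "u + v", OF assms(2,3) _ *]) (rule D)
    have *: "((\<lambda>x. frechet_derivative f (at x) (c *\<^sub>R v)) has_derivative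
        (\<lambda>w. c *\<^sub>R snd_deriv f z v w)) (at z)"
      by (rule has_derivative_transform_within_open[OF has_derivative_scaleR_right[OF D2] assms(2,3)])
         (simp add: linear_scale[OF lin])
    show "snd_deriv f z (c *\<^sub>R v) w = c *\<^sub>R snd_deriv f z v w"
      by (rule snd_deriv_eqI[where D = "\<lambda>x. frechet_derivative f (at x)" and v = "c *\<^sub>R v", OF assms(2,3) _ *]) (rule D)
  qed
  ultimately have "bilinear (snd_deriv f z)"
    unfolding bilinear_def by (auto intro!: linearI simp: linear_iff)
  then show ?thesis by (simp add: bilinear_conv_bounded_bilinear)
qed

text \<open>The point is uniformity in the direction \<open>v\<close>: differentiability of each
  directional derivative at \<open>a\<close> is used for the finitely many basis vectors, and the
  remainder, being linear in \<open>v\<close>, is summed over them.\<close>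

lemma C2_derivative_expansion:
  fixes f :: "'a::euclidean_space \<Rightarrow> real"
  assumes "Ck_on 2 f S" "open S" "a \<in> S" "\<epsilon> > 0"
  obtains r where "r > 0" "ball a r \<subseteq> S"
    "\<And>x v. x \<in> ball a r \<Longrightarrow> \<bar>frechet_derivative f (at x) v - frechet_derivative f (at a) v
         - snd_deriv f a v (x - a)\<bar> \<le> \<epsilon> * norm (x - a) * norm v"
proof -
  let ?D = "\<lambda>x. frechet_derivative f (at x)"
  \<comment> \<open>Each basis vector gets an equal share, so that the sum over the basis costs
    exactly \<epsilon>.\<close>
  let ?e = "\<epsilon> / (real DIM('a))"
  have e: "?e > 0" using assms(4) by simp
  have D2: "((\<lambda>x. ?D x v) has_derivative snd_deriv f a v) (at a)" for v
    by (rule C2_on_has_snd_deriv[OF assms(1,3)])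
  have "\<forall>b\<in>Basis. \<exists>d>0. \<forall>x. norm (x - a) < d \<longrightarrow>
      norm (?D x b - ?D a b - snd_deriv f a b (x - a)) \<le> ?e * norm (x - a)"
    using D2 e unfolding has_derivative_at_alt by blast
  then obtain d where d: "\<And>b. b \<in> Basis \<Longrightarrow> d b > 0"
    "\<And>b x. b \<in> Basis \<Longrightarrow> norm (x - a) < d b \<Longrightarrow>
       norm (?D x b - ?D a b - snd_deriv f a b (x - a)) \<le> ?e * norm (x - a)"
    by metis
  obtain r0 where r0: "r0 > 0" "ball a r0 \<subseteq> S" using assms(2,3) openE by blast
  define r where "r = Min (insert r0 (d ` Basis))"
  have r: "r > 0" "r \<le> r0" "\<And>b. b \<in> Basis \<Longrightarrow> r \<le> d b"
    using d(1) r0(1) by (auto simp: r_def) (meson Min_le dual_order.trans finite_Basis finite_imageI imageI min.cobounded2)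
  show thesis
  proof (rule that[OF r(1)])
    show sub: "ball a r \<subseteq> S" using r(2) r0(2) subset_ball by blast
    fix x v assume x: "x \<in> ball a r"
    interpret B: bounded_bilinear "snd_deriv f a"
      by (rule snd_deriv_bounded_bilinear[OF assms(1-3)])
    have lin: "linear (?D y)" if "y \<in> S" for y
      using C2_on_has_derivative[OF assms(1) that] has_derivative_linear by blast
    define R where "R v = ?D x v - ?D a v - snd_deriv f a v (x - a)" for v
    have "linear R"
      unfolding R_def using lin[of x] lin[OF assms(3)] x sub
      by (auto intro!: linearI simp: linear_add linear_scale B.add_left B.scaleR_left algebra_simps)
    have "R v = R (\<Sum>b\<in>Basis. (v \<bullet> b) *\<^sub>R b)"
      by (simp add: euclidean_representation)
    also have "\<dots> = (\<Sum>b\<in>Basis. (v \<bullet> b) * R b)"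
      by (simp add: linear_sum[OF \<open>linear R\<close>] linear_scale[OF \<open>linear R\<close>])
    also have "\<bar>\<dots>\<bar> \<le> (\<Sum>b\<in>(Basis::'a set). norm v * (?e * norm (x - a)))"
    proof (rule order_trans[OF sum_abs sum_mono])
      fix b :: 'a assume b: "b \<in> Basis"
      have "\<bar>R b\<bar> \<le> ?e * norm (x - a)"
        using d(2)[OF b, of x] r(3)[OF b] x by (auto simp: R_def dist_norm norm_minus_commute)
      then show "\<bar>(v \<bullet> b) * R b\<bar> \<le> norm v * (?e * norm (x - a))"
        unfolding abs_mult using Basis_le_norm[OF b, of v] by (intro mult_mono) auto
    qed
    also have "\<dots> = \<epsilon> * norm (x - a) * norm v" by simp
    finally show "\<bar>?D x v - ?D a v - snd_deriv f a v (x - a)\<bar> \<le> \<epsilon> * norm (x - a) * norm v"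
      by (simp only: R_def)
  qed
qed

text \<open>One application of the mean value theorem along the segment from \<open>a\<close> to
  \<open>x\<close>: the derivative of the Taylor remainder there is the error controlled by
  \<open>C2_derivative_expansion\<close>.\<close>

lemma C2_taylor:
  fixes f :: "'a::euclidean_space \<Rightarrow> real"
  assumes "Ck_on 2 f S" "open S" "a \<in> S" "\<epsilon> > 0"
  obtains r where "r > 0" "ball a r \<subseteq> S"
    "\<And>x. x \<in> ball a r \<Longrightarrow> \<bar>f x - f a - frechet_derivative f (at a) (x - a)
         - snd_deriv f a (x - a) (x - a) / 2\<bar> \<le> \<epsilon> * (norm (x - a))\<^sup>2"
proof -
  obtain r where r: "r > 0" "ball a r \<subseteq> S"
    "\<And>x v. x \<in> ball a r \<Longrightarrow> \<bar>frechet_derivative f (at x) v - frechet_derivative f (at a) v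
         - snd_deriv f a v (x - a)\<bar> \<le> \<epsilon> * norm (x - a) * norm v"
    using C2_derivative_expansion[OF assms] by blast
  show thesis
  proof (rule that[OF r(1,2)])
    fix x assume x: "x \<in> ball a r"
    interpret B: bounded_bilinear "snd_deriv f a"
      by (rule snd_deriv_bounded_bilinear[OF assms(1-3)])
    define h where "h = x - a"
    let ?D = "\<lambda>x. frechet_derivative f (at x)"
    have inb: "a + t *\<^sub>R h \<in> ball a r" if "0 \<le> t" "t \<le> 1" for t
    proof -
      have "norm (t *\<^sub>R h) \<le> norm h" using that by (simp add: mult_left_le_one_le)
      then show ?thesis using x by (simp add: dist_norm h_def norm_minus_commute)
    qed
    define \<phi> where "\<phi> t = f (a + t *\<^sub>R h) - f a - t * ?D a h - t\<^sup>2 * (snd_deriv f a h h / 2)" for t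
    have der: "(\<phi> has_real_derivative ?D (a + t *\<^sub>R h) h - ?D a h - t * snd_deriv f a h h) (at t)"
      if "0 \<le> t" "t \<le> 1" for t
    proof -
      have "(f has_derivative ?D (a + t *\<^sub>R h)) (at (a + t *\<^sub>R h))"
        using C2_on_has_derivative[OF assms(1)] inb[OF that] r(2) by blast
      moreover have "((\<lambda>t. a + t *\<^sub>R h) has_derivative (\<lambda>s. s *\<^sub>R h)) (at t)"
        by (auto intro!: derivative_eq_intros)
      ultimately have "((\<lambda>t. f (a + t *\<^sub>R h)) has_derivative (\<lambda>s. ?D (a + t *\<^sub>R h) (s *\<^sub>R h))) (at t)"
        using diff_chain_at[of "\<lambda>t. a + t *\<^sub>R h" "\<lambda>s. s *\<^sub>R h" t f] by (simp add: o_def)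
      moreover have "linear (?D (a + t *\<^sub>R h))"
        using \<open>(f has_derivative ?D (a + t *\<^sub>R h)) (at (a + t *\<^sub>R h))\<close> has_derivative_linear by blast
      ultimately have *: "((\<lambda>t. f (a + t *\<^sub>R h)) has_real_derivative ?D (a + t *\<^sub>R h) h) (at t)"
        by (auto simp: has_field_derivative_def linear_scale elim!: has_derivative_eq_rhs)
      show ?thesis unfolding \<phi>_def
        by (rule derivative_eq_intros * refl | simp add: field_simps)+
    qed
    obtain t where t: "0 < t" "t < 1"
      "\<phi> 1 - \<phi> 0 = (1 - 0) * (?D (a + t *\<^sub>R h) h - ?D a h - t * snd_deriv f a h h)"
      using MVT2[of 0 1 \<phi>, OF _ der] by auto
    have "\<bar>\<phi> 1 - \<phi> 0\<bar> \<le> \<epsilon> * norm (t *\<^sub>R h) * norm h"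
      using r(3)[OF inb, of t h] t by (simp add: B.scaleR_right)
    also have "\<dots> \<le> \<epsilon> * (norm h)\<^sup>2"
    proof -
      have "t * (norm h)\<^sup>2 \<le> (norm h)\<^sup>2" using t by (simp add: mult_left_le_one_le)
      then show ?thesis using assms(4) t by (simp add: power2_eq_square mult_ac)
    qed
    finally show "\<bar>f x - f a - ?D a (x - a) - snd_deriv f a (x - a) (x - a) / 2\<bar>
        \<le> \<epsilon> * (norm (x - a))\<^sup>2"
      by (simp add: \<phi>_def h_def)
  qed
qed

text \<open>The second difference over a small parallelogram is symmetric in \<open>h\<close> and
  \<open>k\<close>, and approximates both \<open>s\<^sup>2 * snd_deriv f a h k\<close> and
  \<open>s\<^sup>2 * snd_deriv f a k h\<close>. A gap between the two would exceed the
  error.\<close>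

lemma snd_deriv_symmetric:
  fixes f :: "'a::euclidean_space \<Rightarrow> real"
  assumes "Ck_on 2 f S" "open S" "a \<in> S"
  shows "snd_deriv f a h k = snd_deriv f a k h"
proof (rule ccontr)
  assume neq: "snd_deriv f a h k \<noteq> snd_deriv f a k h"
  interpret B: bounded_bilinear "snd_deriv f a"
    by (rule snd_deriv_bounded_bilinear[OF assms(1-3)])
  let ?D = "\<lambda>x. frechet_derivative f (at x)"
  \<comment> \<open>The summand 1 keeps \<open>N\<close> positive when both vectors vanish.\<close>
  define N where "N = norm h + norm k + 1"
  have N: "N > 0" "norm h \<le> N" "norm k \<le> N" "norm h + norm k \<le> N"
    by (auto simp: N_def add_nonneg_pos)
  \<comment> \<open>The two approximation errors will add up to
    \<open>4 * \<epsilon> * N\<^sup>2\<close>, which the factor 8 makes half of the supposed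
    gap.\<close>
  define \<epsilon> where "\<epsilon> = \<bar>snd_deriv f a h k - snd_deriv f a k h\<bar> / (8 * N\<^sup>2)"
  have e: "\<epsilon> > 0" using neq N(1) by (simp add: \<epsilon>_def)
  obtain r where r: "r > 0" "ball a r \<subseteq> S"
    "\<And>x v. x \<in> ball a r \<Longrightarrow> \<bar>?D x v - ?D a v - snd_deriv f a v (x - a)\<bar>
       \<le> \<epsilon> * norm (x - a) * norm v"
    using C2_derivative_expansion[OF assms e] by blast
  \<comment> \<open>Then \<open>s * N\<close> is half of \<open>r\<close>, so the whole
    parallelogram lies in the ball.\<close>
  define s where "s = r / (2 * N)"
  have s: "s > 0" "s * N < r" using r(1) N(1) by (auto simp: s_def)
  define \<Delta> where "\<Delta> h k = f (a + s *\<^sub>R h + s *\<^sub>R k) - f (a + s *\<^sub>R h) - f (a + s *\<^sub>R k) + f a" for h k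
  have dist_add_self: "dist a (a + w) = norm w" for w
    by (simp add: dist_norm)
  have key: "\<bar>\<Delta> h k - s\<^sup>2 * snd_deriv f a h k\<bar> \<le> 2 * \<epsilon> * s\<^sup>2 * N\<^sup>2"
    if hk: "norm h \<le> N" "norm h + norm k \<le> N" for h k
  proof -
    have nrm: "norm (t *\<^sub>R h + c *\<^sub>R k) \<le> s * N" if "0 \<le> t" "t \<le> s" "0 \<le> c" "c \<le> s" for t c
    proof -
      have "norm (t *\<^sub>R h + c *\<^sub>R k) \<le> t * norm h + c * norm k"
        using norm_triangle_ineq[of "t *\<^sub>R h" "c *\<^sub>R k"] that by simp
      also have "\<dots> \<le> s * norm h + s * norm k"
        using that by (intro add_mono mult_right_mono) auto
      also have "\<dots> \<le> s * N" using hk(2) s(1) by (simp flip: distrib_left)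
      finally show ?thesis .
    qed
    have inb: "a + (t *\<^sub>R h + c *\<^sub>R k) \<in> ball a r" if "0 \<le> t" "t \<le> s" "0 \<le> c" "c \<le> s" for t c
      using nrm[OF that] s(2) dist_add_self[of "t *\<^sub>R h + c *\<^sub>R k"] by simp
    have der: "((\<lambda>t. f (a + (t *\<^sub>R h + c *\<^sub>R k))) has_real_derivative ?D (a + (t *\<^sub>R h + c *\<^sub>R k)) h) (at t)"
      if "0 \<le> t" "t \<le> s" "0 \<le> c" "c \<le> s" for t c
    proof -
      let ?y = "a + (t *\<^sub>R h + c *\<^sub>R k)"
      have f: "(f has_derivative ?D ?y) (at ?y)"
        using C2_on_has_derivative[OF assms(1)] inb[OF that] r(2) by blast
      moreover have "((\<lambda>t. a + (t *\<^sub>R h + c *\<^sub>R k)) has_derivative (\<lambda>s. s *\<^sub>R h)) (at t)"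
        by (auto intro!: derivative_eq_intros)
      ultimately have "((\<lambda>t. f (a + (t *\<^sub>R h + c *\<^sub>R k))) has_derivative (\<lambda>s. ?D ?y (s *\<^sub>R h))) (at t)"
        using diff_chain_at[of "\<lambda>t. a + (t *\<^sub>R h + c *\<^sub>R k)" "\<lambda>s. s *\<^sub>R h" t f] by (simp add: o_def)
      moreover have "linear (?D ?y)" using f has_derivative_linear by blast
      ultimately show ?thesis
        by (auto simp: has_field_derivative_def linear_scale elim!: has_derivative_eq_rhs)
    qed
    \<comment> \<open>The second difference is the increment of this first difference over
      \<open>[0, s]\<close>. The summand with factor 0 keeps the shape to which \<open>der\<close>
      and \<open>bd\<close> apply.\<close>
    define \<phi> where "\<phi> t = f (a + (t *\<^sub>R h + s *\<^sub>R k)) - f (a + (t *\<^sub>R h + 0 *\<^sub>R k))" for t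
    have dphi: "(\<phi> has_real_derivative
        ?D (a + (t *\<^sub>R h + s *\<^sub>R k)) h - ?D (a + (t *\<^sub>R h + 0 *\<^sub>R k)) h) (at t)"
      if "0 \<le> t" "t \<le> s" for t
      unfolding \<phi>_def using that s(1) by (intro DERIV_diff der) auto
    obtain t where t: "0 < t" "t < s" "\<phi> s - \<phi> 0 = (s - 0) *
        (?D (a + (t *\<^sub>R h + s *\<^sub>R k)) h - ?D (a + (t *\<^sub>R h + 0 *\<^sub>R k)) h)"
      using MVT2[of 0 s \<phi>, OF s(1) dphi] by auto
    have bd: "\<bar>?D (a + (t *\<^sub>R h + c *\<^sub>R k)) h - ?D a h - snd_deriv f a h (t *\<^sub>R h + c *\<^sub>R k)\<bar>
        \<le> \<epsilon> * (s * N) * N" if "0 \<le> c" "c \<le> s" for c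
    proof -
      have "\<bar>?D (a + (t *\<^sub>R h + c *\<^sub>R k)) h - ?D a h - snd_deriv f a h (t *\<^sub>R h + c *\<^sub>R k)\<bar>
          \<le> \<epsilon> * norm (t *\<^sub>R h + c *\<^sub>R k) * norm h"
        using r(3)[OF inb[of t c], of h] t that by simp
      also have "\<dots> \<le> \<epsilon> * (s * N) * N"
        using nrm[of t c] t that hk(1) e s(1) N(1) by (intro mult_mono) auto
      finally show ?thesis .
    qed
    have D: "\<Delta> h k = s * (?D (a + (t *\<^sub>R h + s *\<^sub>R k)) h - ?D (a + (t *\<^sub>R h + 0 *\<^sub>R k)) h)"
      using t(3) by (simp add: \<Delta>_def \<phi>_def add.assoc)
    have "\<bar>(?D (a + (t *\<^sub>R h + s *\<^sub>R k)) h - ?D (a + (t *\<^sub>R h + 0 *\<^sub>R k)) h) - s * snd_deriv f a h k\<bar>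
        \<le> 2 * (\<epsilon> * (s * N) * N)"
      using bd[of s] bd[of 0] s(1) by (simp add: B.add_right B.scaleR_right)
    then have "s * \<bar>(?D (a + (t *\<^sub>R h + s *\<^sub>R k)) h - ?D (a + (t *\<^sub>R h + 0 *\<^sub>R k)) h) - s * snd_deriv f a h k\<bar>
        \<le> s * (2 * (\<epsilon> * (s * N) * N))"
      using s(1) by (intro mult_left_mono) auto
    moreover have "\<Delta> h k - s\<^sup>2 * snd_deriv f a h k = s *
       ((?D (a + (t *\<^sub>R h + s *\<^sub>R k)) h - ?D (a + (t *\<^sub>R h + 0 *\<^sub>R k)) h) - s * snd_deriv f a h k)"
      unfolding D by (simp add: power2_eq_square algebra_simps)
    ultimately show ?thesis using s(1) by (simp add: abs_mult power2_eq_square mult_ac)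
  qed
  have "\<Delta> h k = \<Delta> k h" by (simp add: \<Delta>_def add_ac)
  then have "\<bar>s\<^sup>2 * snd_deriv f a h k - s\<^sup>2 * snd_deriv f a k h\<bar> \<le> 4 * \<epsilon> * s\<^sup>2 * N\<^sup>2"
    using key[of h k] key[of k h] N by (simp add: add.commute)
  moreover have "\<bar>s\<^sup>2 * snd_deriv f a h k - s\<^sup>2 * snd_deriv f a k h\<bar>
      = s\<^sup>2 * \<bar>snd_deriv f a h k - snd_deriv f a k h\<bar>"
    by (simp add: abs_mult flip: right_diff_distrib)
  ultimately have "s\<^sup>2 * \<bar>snd_deriv f a h k - snd_deriv f a k h\<bar> \<le> s\<^sup>2 * (4 * \<epsilon> * N\<^sup>2)"
    by (simp add: mult_ac)
  then have "\<bar>snd_deriv f a h k - snd_deriv f a k h\<bar> \<le> 4 * \<epsilon> * N\<^sup>2"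
    using s(1) by simp
  also have "\<dots> = \<bar>snd_deriv f a h k - snd_deriv f a k h\<bar> / 2"
    using N(1) by (simp add: \<epsilon>_def)
  finally show False using neq by simp
qed

section \<open>The complex Hessian\<close>

text \<open>The mixed Wirtinger derivatives written out for a real bilinear form. The index
  \<open>j\<close> sits in the first slot because the antiholomorphic derivative is taken
  first.\<close>

definition levi_matrix :: "(complex^'n \<Rightarrow> complex^'n \<Rightarrow> real) \<Rightarrow> complex^'n^'n" where
  "levi_matrix s = (\<chi> i j.
     (of_real (s (axis j 1) (axis i 1)) + \<i> * of_real (s (axis j \<i>) (axis i 1))
       - \<i> * (of_real (s (axis j 1) (axis i \<i>)) + \<i> * of_real (s (axis j \<i>) (axis i \<i>)))) / 4)"

text \<open>Reduces all later computations with complex Hessians to algebra on the real second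
  derivative.\<close>

lemma complex_hessian_eq_levi:
  assumes "Ck_on 2 f S" "open S" "z \<in> S"
  shows "complex_hessian f z = levi_matrix (snd_deriv f z)"
proof -
  let ?D = "\<lambda>x. frechet_derivative f (at x)"
  have D: "(f has_derivative ?D x) (at x)" if "x \<in> S" for x
    by (rule C2_on_has_derivative[OF assms(1) that])
  have D2: "((\<lambda>x. ?D x v) has_derivative snd_deriv f z v) (at z)" for v
    by (rule C2_on_has_snd_deriv[OF assms(1,3)])
  have d_zbar: "d_zbar j (\<lambda>w. complex_of_real (f w)) x
      = (of_real (?D x (axis j 1)) + \<i> * of_real (?D x (axis j \<i>))) / 2" if "x \<in> S" for x j
    unfolding d_zbar_def frechet_derivative_eqI[OF has_derivative_of_real[OF D[OF that]]] ..
  have "(d_zbar j (\<lambda>w. complex_of_real (f w)) has_derivative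
      (\<lambda>w. (of_real (snd_deriv f z (axis j 1) w) + \<i> * of_real (snd_deriv f z (axis j \<i>) w)) / 2)) (at z)" for j
    by (rule has_derivative_transform_within_open[OF _ assms(2,3) d_zbar[symmetric]])
       (intro derivative_intros D2 has_derivative_divide' bounded_linear.has_derivative[OF bounded_linear_divide])
  from frechet_derivative_eqI[OF this]
  show ?thesis
    by (simp add: complex_hessian_def d_z_def levi_matrix_def vec_eq_iff field_simps)
qed

lemma complex_hessian_cong_open:
  assumes "Ck_on 2 f S" "open S" "z \<in> S" "\<And>x. x \<in> S \<Longrightarrow> f x = g x"
  shows "complex_hessian f z = complex_hessian g z"
proof -
  have "Ck_on 2 g S" using assms(1) Ck_on_cong[OF assms(2,4)] by simp
  moreover have "snd_deriv f z = snd_deriv g z"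
    by (intro ext snd_deriv_cong_open[OF assms(2,3,4)])
  ultimately show ?thesis using assms by (simp add: complex_hessian_eq_levi)
qed

section \<open>Hessians of sums and of quadratic polynomials\<close>

lemma levi_matrix_add: "levi_matrix (\<lambda>v w. s v w + t v w) = levi_matrix s + levi_matrix t"
  by (simp add: levi_matrix_def vec_eq_iff field_simps)

lemma levi_matrix_diff: "levi_matrix (\<lambda>v w. s v w - t v w) = levi_matrix s - levi_matrix t"
  by (simp add: levi_matrix_def vec_eq_iff field_simps)

text \<open>The form on the left is the real second derivative of \<delta> times the squared
  norm.\<close>

lemma levi_matrix_inner: "levi_matrix (\<lambda>v w. 2 * \<delta> * (v \<bullet> w)) = mat (of_real \<delta>)"
  by (simp add: levi_matrix_def vec_eq_iff mat_def inner_axis_axis inner_complex_def)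

lemma snd_deriv_add:
  assumes "Ck_on 2 f S" "Ck_on 2 g S" "open S" "z \<in> S"
  shows "snd_deriv (\<lambda>x. f x + g x) z v w = snd_deriv f z v w + snd_deriv g z v w"
proof (rule snd_deriv_eqI[OF assms(3,4)])
  show "((\<lambda>x. f x + g x) has_derivative
      (\<lambda>v. frechet_derivative f (at x) v + frechet_derivative g (at x) v)) (at x)" if "x \<in> S" for x
    by (rule has_derivative_add C2_on_has_derivative assms that)+
  show "((\<lambda>x. frechet_derivative f (at x) v + frechet_derivative g (at x) v) has_derivative
      (\<lambda>w. snd_deriv f z v w + snd_deriv g z v w)) (at z)"
    by (rule has_derivative_add C2_on_has_snd_deriv assms)+
qed

lemma complex_hessian_add:
  assumes "Ck_on 2 f S" "Ck_on 2 g S" "open S" "z \<in> S"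
  shows "complex_hessian (\<lambda>x. f x + g x) z = complex_hessian f z + complex_hessian g z"
proof -
  have "snd_deriv (\<lambda>x. f x + g x) z = (\<lambda>v w. snd_deriv f z v w + snd_deriv g z v w)"
    by (intro ext snd_deriv_add[OF assms])
  then show ?thesis
    using complex_hessian_eq_levi[OF Ck_on_add[OF assms(3,1,2)] assms(3,4)]
      complex_hessian_eq_levi[OF assms(1,3,4)] complex_hessian_eq_levi[OF assms(2,3,4)]
    by (simp add: levi_matrix_add)
qed

text \<open>Meant for \<open>h\<close> a transition map between charts: the rules for linear and
  bilinear maps settle smoothness of the composite without a general chain rule.\<close>

lemma Ck_on_quadratic_compose:
  fixes L :: "'a::real_normed_vector \<Rightarrow> 'c::real_normed_vector"
  assumes "bounded_linear L" "bounded_bilinear B" "open S" "Ck_on k h S"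
  shows "Ck_on k (\<lambda>x. c + L (h x - a) + B (h x - a) (h x - a)) S"
proof -
  have h: "Ck_on k (\<lambda>x. h x - a) S"
    using Ck_on_add[OF assms(3,4) Ck_on_const[where c = "- a"]] by simp
  show ?thesis
    by (intro Ck_on_add Ck_on_const Ck_on_bounded_linear[OF assms(1)]
        Ck_on_bounded_bilinear[OF assms(2)] h assms(3))
qed

lemma snd_deriv_quadratic:
  fixes L :: "'a::real_normed_vector \<Rightarrow> 'c::real_normed_vector"
  assumes "bounded_linear L" "bounded_bilinear B"
  shows "snd_deriv (\<lambda>x. c + L (x - a) + B (x - a) (x - a)) z v w = B w v + B v w"
proof (rule snd_deriv_eqI[OF open_UNIV UNIV_I])
  interpret L: bounded_linear L by fact
  interpret B: bounded_bilinear B by fact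
  show "((\<lambda>x. c + L (x - a) + B (x - a) (x - a)) has_derivative
      (\<lambda>v. L v + (B (x - a) v + B v (x - a)))) (at x)" for x
    by (auto intro!: derivative_eq_intros L.has_derivative B.FDERIV)
  show "((\<lambda>x. L v + (B (x - a) v + B v (x - a))) has_derivative (\<lambda>w. B w v + B v w)) (at z)"
    by (auto intro!: derivative_eq_intros L.has_derivative B.FDERIV simp: B.zero_left B.zero_right)
qed

text \<open>The second-order Taylor polynomial, lowered by \<open>\<delta> |x - a|\<^sup>2\<close> to absorb the remainder.\<close>

lemma C2_quadratic_minorant:
  fixes f :: "complex^'n \<Rightarrow> real"
  assumes "Ck_on 2 f S" "open S" "a \<in> S" "\<delta> > 0"
  obtains Q r where "r > 0" "ball a r \<subseteq> S" "Q a = f a" "\<And>x. x \<in> ball a r \<Longrightarrow> Q x \<le> f x"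
    "\<And>k (h :: complex^'n \<Rightarrow> complex^'n) T. open T \<Longrightarrow> Ck_on k h T \<Longrightarrow> Ck_on k (\<lambda>x. Q (h x)) T"
    "\<And>z. complex_hessian Q z = complex_hessian f a - mat (of_real \<delta>)"
proof -
  let ?s = "snd_deriv f a"
  let ?L = "frechet_derivative f (at a)"
  \<comment> \<open>The quadratic Taylor term minus the correction that turns the two-sided
    remainder estimate into a lower bound for \<open>f\<close>.\<close>
  define B where "B v w = ?s v w / 2 - \<delta> * (v \<bullet> w)" for v w
  interpret s: bounded_bilinear ?s by (rule snd_deriv_bounded_bilinear[OF assms(1-3)])
  have "bilinear B"
    unfolding bilinear_def B_def
    by (auto intro!: linearI simp: s.add_left s.add_right s.scaleR_left s.scaleR_right
        inner_add_left inner_add_right algebra_simps add_divide_distrib)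
  then have B: "bounded_bilinear B" by (simp add: bilinear_conv_bounded_bilinear)
  have L: "bounded_linear ?L"
    by (rule has_derivative_bounded_linear[OF C2_on_has_derivative[OF assms(1,3)]])
  define Q where "Q x = f a + ?L (x - a) + B (x - a) (x - a)" for x
  interpret L: bounded_linear ?L by (rule L)
  interpret B: bounded_bilinear B by (rule B)
  obtain r where r: "r > 0" "ball a r \<subseteq> S"
    "\<And>x. x \<in> ball a r \<Longrightarrow> \<bar>f x - f a - ?L (x - a) - ?s (x - a) (x - a) / 2\<bar> \<le> \<delta> * (norm (x - a))\<^sup>2"
    using C2_taylor[OF assms] by blast
  show thesis
  proof (rule that[OF r(1,2)])
    show "Q a = f a" by (simp add: Q_def L.zero B.zero_left)
    show "Q x \<le> f x" if "x \<in> ball a r" for x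
      using r(3)[OF that] by (simp add: Q_def B_def abs_le_iff flip: power2_norm_eq_inner)
    show CkQ: "Ck_on k (\<lambda>x. Q (h x)) T" if "open T" "Ck_on k h T" for k T and h :: "complex^'n \<Rightarrow> complex^'n"
      unfolding Q_def by (rule Ck_on_quadratic_compose[OF L B that])
    fix z
    have "Ck_on 2 Q UNIV" using CkQ[OF open_UNIV Ck_on_id[OF open_UNIV]] by simp
    then have "complex_hessian Q z = levi_matrix (snd_deriv Q z)"
      by (rule complex_hessian_eq_levi) auto
    also have "snd_deriv Q z = (\<lambda>v w. ?s v w - 2 * \<delta> * (v \<bullet> w))"
    proof (intro ext)
      fix v w
      \<comment> \<open>Differentiating the quadratic term symmetrizes \<open>B\<close>; symmetry of
        the second derivative recovers \<open>?s\<close> itself.\<close>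
      have "B w v + B v w = ?s v w - 2 * \<delta> * (v \<bullet> w)"
        using snd_deriv_symmetric[OF assms(1-3), of w v] by (simp add: B_def inner_commute)
      then show "snd_deriv Q z v w = ?s v w - 2 * \<delta> * (v \<bullet> w)"
        unfolding Q_def snd_deriv_quadratic[OF L B] .
    qed
    also have "levi_matrix \<dots> = complex_hessian f a - mat (of_real \<delta>)"
      by (simp only: levi_matrix_diff levi_matrix_inner complex_hessian_eq_levi[OF assms(1-3)])
    finally show "complex_hessian Q z = complex_hessian f a - mat (of_real \<delta>)" .
  qed
qed

text \<open>For the limit argument: the exponent is lowered away from \<open>a\<close>, while a
  constant Hessian stays constant.\<close>

lemma complex_hessian_diff_norm:
  fixes T :: "complex^'n \<Rightarrow> real"
  assumes "Ck_on 2 T UNIV"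
  shows "Ck_on 2 (\<lambda>z. T z - \<delta> * (norm (z - a))\<^sup>2) UNIV"
    and "complex_hessian (\<lambda>z. T z - \<delta> * (norm (z - a))\<^sup>2) z = complex_hessian T z - mat (of_real \<delta>)"
proof -
  \<comment> \<open>The zero constant and linear parts bring \<open>q\<close> into the form required
    by the lemmas on quadratic polynomials.\<close>
  define q where "q = (\<lambda>z::complex^'n. 0 + 0 + (- \<delta>) * ((z - a) \<bullet> (z - a)))"
  have L: "bounded_linear (\<lambda>_::complex^'n. 0::real)" by (rule bounded_linear_zero)
  have B: "bounded_bilinear (\<lambda>v w::complex^'n. (- \<delta>) * (v \<bullet> w))"
    by (auto simp: bilinear_conv_bounded_bilinear[symmetric] bilinear_def inner_add_left inner_add_right
        algebra_simps intro!: linearI)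
  have q: "Ck_on 2 q UNIV"
    unfolding q_def by (rule Ck_on_quadratic_compose[OF L B open_UNIV Ck_on_id[OF open_UNIV]])
  have eq: "(\<lambda>z. T z - \<delta> * (norm (z - a))\<^sup>2) = (\<lambda>z. T z + q z)"
    by (simp add: q_def power2_norm_eq_inner)
  have "snd_deriv q z = (\<lambda>v w. 2 * (- \<delta>) * (v \<bullet> w))"
    unfolding q_def by (intro ext, subst snd_deriv_quadratic[OF L B]) (simp add: inner_commute)
  then have "complex_hessian q z = levi_matrix (\<lambda>v w. 2 * (- \<delta>) * (v \<bullet> w))"
    by (simp only: complex_hessian_eq_levi[OF q open_UNIV UNIV_I])
  also have "\<dots> = mat (of_real (- \<delta>))" by (rule levi_matrix_inner)
  finally have "complex_hessian q z = - mat (of_real \<delta>)" by (simp add: mat_def vec_eq_iff)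
  then show "complex_hessian (\<lambda>z. T z - \<delta> * (norm (z - a))\<^sup>2) z = complex_hessian T z - mat (of_real \<delta>)"
    unfolding eq complex_hessian_add[OF assms q open_UNIV UNIV_I] by simp
  show "Ck_on 2 (\<lambda>z. T z - \<delta> * (norm (z - a))\<^sup>2) UNIV"
    unfolding eq by (rule Ck_on_add[OF open_UNIV assms q])
qed

section \<open>Shifting the spectrum by a scalar\<close>

lemma eigenspace_diff_mat: "eigenspace (H - mat d) l = eigenspace H (l + d)"
proof -
  have "(H - mat d) *v v = H *v v - d *s v" for v
    by (simp add: vec_eq_iff matrix_vector_mult_def mat_def left_diff_distrib sum_subtractf
        if_distrib[of "\<lambda>c. c * _"] cong: if_cong)
  then show ?thesis
    by (auto simp: eigenspace_def vec_eq_iff algebra_simps)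
qed

text \<open>The eigenvalues of \<open>H - \<delta>\<close> are those of \<open>H\<close> shifted by \<open>\<delta>\<close>; the positive ones stay positive.\<close>

lemma num_pos_eigenvalues_diff_mat:
  obtains \<delta> where "\<delta> > 0" "num_pos_eigenvalues H \<le> num_pos_eigenvalues (H - mat (of_real \<delta>))"
proof -
  define E where "E H = {r::real. 0 < r \<and> (\<exists>v\<in>eigenspace H (of_real r). v \<noteq> 0)}"
    for H :: "complex^'a^'a"
  have num: "num_pos_eigenvalues H = (\<Sum>r\<in>E H. vec.dim (eigenspace H (of_real r)))"
    for H :: "complex^'a^'a"
    by (simp add: num_pos_eigenvalues_def E_def)
  show thesis
  proof (cases "finite (E H)")
    case False
    \<comment> \<open>A sum over an infinite set is 0 by convention, so any \<delta> serves;
      finiteness of the spectrum need not be proved.\<close>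
    then show thesis by (intro that[of 1]) (auto simp: num)
  next
    case True
    \<comment> \<open>Half the least positive eigenvalue, capped at 1/2; the inserted 1 keeps the
      minimum meaningful when there is no positive eigenvalue.\<close>
    define \<delta> where "\<delta> = Min (insert 1 (E H)) / 2"
    have "Min (insert 1 (E H)) > 0"
      using True by (auto simp: E_def)
    moreover have "Min (insert 1 (E H)) \<le> r" if "r \<in> E H" for r
      using True that by simp
    ultimately have \<delta>: "\<delta> > 0" "\<And>r. r \<in> E H \<Longrightarrow> \<delta> < r"
      unfolding \<delta>_def by fastforce+
    have "(\<Sum>r\<in>E H. vec.dim (eigenspace H (of_real r)))
        = (\<Sum>r\<in>E (H - mat (of_real \<delta>)). vec.dim (eigenspace (H - mat (of_real \<delta>)) (of_real r)))"
      by (rule sum.reindex_bij_witness[where i = "\<lambda>r. r + \<delta>" and j = "\<lambda>r. r - \<delta>"])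
         (use \<delta> in \<open>force simp: E_def eigenspace_diff_mat\<close>)+
    then show thesis
      using that[OF \<delta>(1)] by (simp add: num)
  qed
qed

section \<open>Holomorphic functions of several variables\<close>

lemma holo_on_has_derivative:
  assumes "holo_on f S" "z \<in> S"
  shows "(f has_derivative frechet_derivative f (at z)) (at z)"
  using assms unfolding holo_on_def differentiable_def
  by (metis frechet_derivative_eqI)

lemma holo_on_frechet_cmul:
  assumes "holo_on f S" "z \<in> S"
  shows "frechet_derivative f (at z) (c *s v) = c * frechet_derivative f (at z) v"
  using assms unfolding holo_on_def by (metis frechet_derivative_eqI)

lemma holo_on_imp_continuous_on: "holo_on f S \<Longrightarrow> continuous_on S f"
  by (meson continuous_at_imp_continuous_on has_derivative_continuous holo_on_has_derivative)

lemma norm_vector_scalar_mult: "norm (c *s v) = norm c * norm v" for v :: "complex^'n"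
  by (simp add: norm_vec_def norm_mult L2_set_right_distrib)

lemma bounded_linear_scalar_mult_left: "bounded_linear (\<lambda>c. c *s v)" for v :: "complex^'n"
  by (rule bounded_linear_intro[where K = "norm v"])
     (auto simp: norm_vector_scalar_mult vec_eq_iff algebra_simps)

section \<open>Cauchy's formula along complex lines\<close>

lemma holo_on_line_has_field_derivative:
  assumes "holo_on f S" "z + \<zeta> *s v \<in> S"
  shows "((\<lambda>\<zeta>. f (z + \<zeta> *s v)) has_field_derivative frechet_derivative f (at (z + \<zeta> *s v)) v) (at \<zeta>)"
proof -
  have "((\<lambda>\<zeta>. z + \<zeta> *s v) has_derivative (\<lambda>\<eta>. \<eta> *s v)) (at \<zeta>)"
    by (auto intro!: derivative_eq_intros bounded_linear.has_derivative[OF bounded_linear_scalar_mult_left])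
  from diff_chain_at[OF this holo_on_has_derivative[OF assms]]
  moreover have "(\<lambda>\<eta>. frechet_derivative f (at (z + \<zeta> *s v)) (\<eta> *s v))
      = (*) (frechet_derivative f (at (z + \<zeta> *s v)) v)"
    by (simp add: fun_eq_iff holo_on_frechet_cmul[OF assms] mult.commute)
  ultimately show ?thesis
    by (simp add: o_def has_field_derivative_def)
qed

text \<open>Cauchy's formula for the first derivative at 0 of \<open>f\<close> on the complex line
  through \<open>z\<close> in direction \<open>v\<close>. The circle is parametrized over
  \<open>[0, 1]\<close> so that results on parameter integrals apply.\<close>

lemma holo_on_cauchy_integral:
  assumes "holo_on f S" "\<rho> > 0" "\<And>\<zeta>. norm \<zeta> \<le> \<rho> \<Longrightarrow> z + \<zeta> *s v \<in> S"
    and c: "c = (\<lambda>t::real. of_real \<rho> * exp (2 * of_real pi * \<i> * of_real t))"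
  shows "frechet_derivative f (at z) v = integral (cbox 0 1) (\<lambda>t. f (z + c t *s v) / c t)"
proof -
  let ?g = "\<lambda>\<zeta>. f (z + \<zeta> *s v)"
  have der: "(?g has_field_derivative frechet_derivative f (at (z + \<zeta> *s v)) v) (at \<zeta>)"
    if "norm \<zeta> \<le> \<rho>" for \<zeta>
    by (rule holo_on_line_has_field_derivative[OF assms(1) assms(3)[OF that]])
  have "continuous_on (cball 0 \<rho>) ?g"
    by (intro continuous_at_imp_continuous_on ballI DERIV_isCont[OF der]) simp
  moreover have "?g holomorphic_on ball 0 \<rho>"
    unfolding holomorphic_on_def field_differentiable_def
    by (intro ballI exI, rule has_field_derivative_at_within[OF der]) simp
  ultimately have "((\<lambda>u. ?g u / (u - 0) ^ Suc 1) has_contour_integral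
      (2 * pi * \<i>) / fact 1 * (deriv ^^ 1) ?g 0) (circlepath 0 \<rho>)"
    by (rule Cauchy_has_contour_integral_higher_derivative_circlepath) (use assms(2) in auto)
  moreover have "deriv ?g 0 = frechet_derivative f (at z) v"
    using DERIV_imp_deriv[OF der[of 0]] assms(2) by simp
  ultimately have "((\<lambda>t. ?g (circlepath 0 \<rho> t) / (circlepath 0 \<rho> t)\<^sup>2 *
      vector_derivative (circlepath 0 \<rho>) (at t within {0..1})) has_integral
      2 * pi * \<i> * frechet_derivative f (at z) v) {0..1}"
    by (simp add: has_contour_integral_def power2_eq_square)
  \<comment> \<open>The velocity of the circle is \<open>2 * pi * \<i> * c t\<close>; it cancels one
    power of \<open>c t\<close> and, after scaling, the constant.\<close>
  then have "((\<lambda>t. ?g (c t) / (c t)\<^sup>2 * (2 * pi * \<i> * c t)) has_integral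
      2 * pi * \<i> * frechet_derivative f (at z) v) {0..1}"
    by (rule has_integral_eq[rotated]) (simp add: vector_derivative_circlepath01, simp add: c circlepath)
  from has_integral_mult_right[OF this, of "1 / (2 * pi * \<i>)"]
  have "((\<lambda>t. 1 / (2 * pi * \<i>) * (?g (c t) / (c t)\<^sup>2 * (2 * pi * \<i> * c t))) has_integral
      frechet_derivative f (at z) v) {0..1}"
    by simp
  then have "((\<lambda>t. ?g (c t) / c t) has_integral frechet_derivative f (at z) v) {0..1}"
    by (rule has_integral_eq[rotated]) (use assms(2) in \<open>simp add: c power2_eq_square\<close>)
  then show ?thesis by (simp add: integral_unique cbox_interval)
qed

text \<open>A single radius must serve all centres near \<open>z0\<close>, so that the Cauchy
  integrals run over a fixed parameter circle.\<close>

lemma cauchy_circle_nbhd: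
  fixes S :: "(complex^'n) set"
  assumes "open S" "z0 \<in> S"
  obtains R \<rho> where "R > 0" "\<rho> > 0"
    "\<And>z \<zeta>. z \<in> ball z0 R \<Longrightarrow> norm \<zeta> \<le> \<rho> \<Longrightarrow> z + \<zeta> *s v \<in> S"
proof -
  obtain r where r: "r > 0" "ball z0 r \<subseteq> S" using assms openE by blast
  \<comment> \<open>Positive even for \<open>v = 0\<close>.\<close>
  define N where "N = norm v + 1"
  have nv: "N > 0" "norm v \<le> N" by (simp_all add: N_def add_nonneg_pos)
  define \<rho> where "\<rho> = r / 2 / N"
  have "\<rho> > 0" using r nv by (simp add: \<rho>_def)
  show thesis
  proof (rule that[of "r / 2" \<rho>])
    show "r / 2 > 0" "\<rho> > 0" using r \<open>\<rho> > 0\<close> by auto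
    fix z :: "complex^'n" and \<zeta> :: complex
    assume z: "z \<in> ball z0 (r / 2)" and \<zeta>: "norm \<zeta> \<le> \<rho>"
    have "norm (\<zeta> *s v) \<le> \<rho> * N"
      unfolding norm_vector_scalar_mult using \<zeta> nv \<open>\<rho> > 0\<close> by (intro mult_mono) auto
    also have "\<dots> = r / 2" using nv by (simp add: \<rho>_def)
    finally have "dist z (z + \<zeta> *s v) \<le> r / 2" by (simp add: dist_norm)
    then have "dist z0 (z + \<zeta> *s v) < r"
      using dist_triangle[of z0 "z + \<zeta> *s v" z] z by simp
    then show "z + \<zeta> *s v \<in> S" using r(2) by auto
  qed
qed

text \<open>\<open>holo_on\<close> gives only pointwise derivatives. Cauchy's formula expresses them
  by values of \<open>f\<close>, which is continuous, and continuity passes under the integral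
  sign.\<close>

lemma holo_on_directional_derivative_continuous:
  assumes "open S" "holo_on f S"
  shows "continuous_on S (\<lambda>z. frechet_derivative f (at z) v)"
proof (rule continuous_at_imp_continuous_on, rule ballI)
  fix z0 assume "z0 \<in> S"
  then obtain R \<rho> where R: "R > 0" "\<rho> > 0"
    "\<And>z \<zeta>. z \<in> ball z0 R \<Longrightarrow> norm \<zeta> \<le> \<rho> \<Longrightarrow> z + \<zeta> *s v \<in> S"
    using cauchy_circle_nbhd[OF assms(1)] by metis
  define c where "c = (\<lambda>t::real. of_real \<rho> * exp (2 * of_real pi * \<i> * of_real t))"
  have c: "norm (c t) = \<rho>" "c t \<noteq> 0" for t
    using R(2) by (auto simp: c_def norm_mult norm_exp)
  have "continuous_on (ball z0 R \<times> cbox 0 1) (\<lambda>(z, t). f (z + c t *s v) / c t)"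
    unfolding split_beta
    by (intro continuous_intros continuous_on_compose2[OF holo_on_imp_continuous_on[OF assms(2)]]
        bounded_linear.continuous_on[OF bounded_linear_scalar_mult_left])
       (use c R(3) in \<open>auto simp: c_def intro!: continuous_intros\<close>)
  then have "continuous_on (ball z0 R) (\<lambda>z. integral (cbox 0 1) (\<lambda>t. f (z + c t *s v) / c t))"
    by (rule integral_continuous_on_param)
  then have "continuous_on (ball z0 R) (\<lambda>z. frechet_derivative f (at z) v)"
    by (rule continuous_on_eq) (simp add: holo_on_cauchy_integral[OF assms(2) R(2,3) c_def])
  then show "isCont (\<lambda>z. frechet_derivative f (at z) v) z0"
    using R(1) by (auto simp: continuous_on_eq_continuous_at)
qed

text \<open>Differentiate the Cauchy integral of the directional derivative under the integral sign.\<close>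

lemma holo_on_directional_derivative:
  assumes "open S" "holo_on f S"
  shows "holo_on (\<lambda>z. frechet_derivative f (at z) v) S"
  unfolding holo_on_def
proof
  fix z0 assume "z0 \<in> S"
  then obtain R \<rho> where R: "R > 0" "\<rho> > 0"
    "\<And>z \<zeta>. z \<in> ball z0 R \<Longrightarrow> norm \<zeta> \<le> \<rho> \<Longrightarrow> z + \<zeta> *s v \<in> S"
    using cauchy_circle_nbhd[OF assms(1)] by metis
  define c where "c = (\<lambda>t::real. of_real \<rho> * exp (2 * of_real pi * \<i> * of_real t))"
  have c: "norm (c t) = \<rho>" "c t \<noteq> 0" for t
    using R(2) by (auto simp: c_def norm_mult norm_exp)
  have contc: "continuous_on T c" for T unfolding c_def by (intro continuous_intros)
  let ?D = "\<lambda>z. frechet_derivative f (at z)"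
  have S: "z + c t *s v \<in> S" if "z \<in> ball z0 R" for z t
    using R(3)[OF that] c(1) by simp
  \<comment> \<open>The Leibniz rule asks for a jointly continuous operator-valued derivative; in
    finite dimension continuity can be checked on each vector.\<close>
  define F where "F z t = Blinfun (\<lambda>w. ?D (z + c t *s v) w / c t)" for z t
  have F: "blinfun_apply (F z t) = (\<lambda>w. ?D (z + c t *s v) w / c t)" if "z \<in> ball z0 R" for z t
    unfolding F_def
    by (rule bounded_linear_Blinfun_apply bounded_linear_divide[THEN bounded_linear_compose]
        has_derivative_bounded_linear holo_on_has_derivative assms(2) S that)+
  have shift: "continuous_on (ball z0 R \<times> cbox 0 1) (\<lambda>x. fst x + c (snd x) *s v)"
    by (intro continuous_intros continuous_on_compose2[OF contc]
        bounded_linear.continuous_on[OF bounded_linear_scalar_mult_left]) auto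
  have contF: "continuous_on (ball z0 R \<times> cbox 0 1) (\<lambda>(z, t). F z t)"
    unfolding split_beta
  proof (rule continuous_on_blinfun_componentwise)
    fix w :: "complex^'a"
    have "continuous_on (ball z0 R \<times> cbox 0 1) (\<lambda>x. ?D (fst x + c (snd x) *s v) w / c (snd x))"
      by (intro continuous_intros continuous_on_compose2[OF contc]
          continuous_on_compose2[OF holo_on_directional_derivative_continuous[OF assms] shift])
         (use c S in auto)
    then show "continuous_on (ball z0 R \<times> cbox 0 1) (\<lambda>x. blinfun_apply (F (fst x) (snd x)) w)"
      by (rule iffD2[OF continuous_on_cong[OF refl], rotated]) (auto simp: F)
  qed
  have z0: "z0 \<in> ball z0 R" using R(1) by simp
  have "((\<lambda>z. integral (cbox 0 1) (\<lambda>t. f (z + c t *s v) / c t)) has_derivative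
      integral (cbox 0 1) (F z0)) (at z0 within ball z0 R)"
  proof (rule leibniz_rule[OF _ _ contF z0 convex_ball])
    fix z and t :: real assume z: "z \<in> ball z0 R"
    have "((\<lambda>z. z + c t *s v) has_derivative (\<lambda>w. w)) (at z)"
      by (auto intro!: derivative_eq_intros)
    from diff_chain_at[OF this holo_on_has_derivative[OF assms(2) S[OF z]]]
    have "((\<lambda>z. f (z + c t *s v)) has_derivative ?D (z + c t *s v)) (at z)"
      by (simp add: o_def)
    from bounded_linear.has_derivative[OF bounded_linear_divide this]
    show "((\<lambda>z. f (z + c t *s v) / c t) has_derivative blinfun_apply (F z t)) (at z within ball z0 R)"
      unfolding F[OF z] by (rule has_derivative_at_withinI)
    show "(\<lambda>t. f (z + c t *s v) / c t) integrable_on cbox 0 1"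
      by (intro integrable_continuous continuous_intros contc
          continuous_on_compose2[OF holo_on_imp_continuous_on[OF assms(2)]]
          bounded_linear.continuous_on[OF bounded_linear_scalar_mult_left])
         (use c S[OF z] in auto)
  qed
  then have "((\<lambda>z. integral (cbox 0 1) (\<lambda>t. f (z + c t *s v) / c t)) has_derivative
      integral (cbox 0 1) (F z0)) (at z0)"
    using at_within_open[OF z0] by simp
  then have der: "((\<lambda>z. ?D z v) has_derivative integral (cbox 0 1) (F z0)) (at z0)"
    by (rule has_derivative_transform_within_open[OF _ open_ball z0])
       (simp add: holo_on_cauchy_integral[OF assms(2) R(2,3) c_def])
  have "F z0 integrable_on cbox 0 1"
    using continuous_on_compose2[OF contF, of "cbox 0 1" "\<lambda>t. (z0, t)"] z0
    by (intro integrable_continuous) (simp add: image_subset_iff continuous_on_Pair)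
  then have "blinfun_apply (integral (cbox 0 1) (F z0)) w = integral (cbox 0 1) (\<lambda>t. ?D (z0 + c t *s v) w / c t)" for w
    by (simp add: blinfun_apply_integral F[OF z0])
  \<comment> \<open>Complex linearity of the derivatives on the circle survives integration.\<close>
  then have "blinfun_apply (integral (cbox 0 1) (F z0)) (a *s w)
      = a * blinfun_apply (integral (cbox 0 1) (F z0)) w" for a w
    by (simp add: holo_on_frechet_cmul[OF assms(2) S[OF z0]] flip: integral_mult_right)
  with der show "\<exists>D. ((\<lambda>z. ?D z v) has_derivative D) (at z0) \<and> (\<forall>c v. D (c *s v) = c * D v)"
    by blast
qed

text \<open>Directional derivatives of holomorphic functions are again holomorphic, so the induction
  on \<open>k\<close> feeds itself.\<close>

lemma holo_on_imp_Ck_on: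
  assumes "open S" "holo_on f S"
  shows "Ck_on k f S"
  using assms(2)
proof (induction k arbitrary: f)
  case 0
  then show ?case by (simp add: holo_on_imp_continuous_on)
next
  case (Suc k)
  then show ?case
    by (auto intro: Suc.IH holo_on_directional_derivative[OF assms(1)]
        simp: differentiable_def intro: holo_on_has_derivative)
qed

lemma Ck_on_sum:
  assumes "open S" "\<And>i. i \<in> I \<Longrightarrow> Ck_on k (f i) S"
  shows "Ck_on k (\<lambda>x. \<Sum>i\<in>I. f i x) S"
  using assms(2)
  by (induction I rule: infinite_finite_induct) (auto intro: Ck_on_const Ck_on_add[OF assms(1)])

lemma holo_map_on_imp_Ck_on:
  fixes h :: "complex^'n \<Rightarrow> complex^'m"
  assumes "open S" "holo_map_on h S"
  shows "Ck_on k h S"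
proof -
  have "bounded_linear (axis i :: complex \<Rightarrow> complex^'m)" for i
    by (rule linear_conv_bounded_linear[THEN iffD1], rule linearI) (auto simp: vec_eq_iff axis_def)
  then have "Ck_on k (\<lambda>z. \<Sum>i\<in>UNIV. axis i (h z $ i)) S"
    using assms unfolding holo_map_on_def
    by (intro Ck_on_sum Ck_on_bounded_linear[where L = "axis _"] holo_on_imp_Ck_on) auto
  moreover have "(\<Sum>i\<in>UNIV. axis i (h z $ i)) = h z" for z
    by (simp add: vec_eq_iff axis_def if_distrib cong: if_cong)
  ultimately show ?thesis by simp
qed

text \<open>The second derivative of \<open>h\<close> is complex linear in both slots: in the first
  by differentiating the complex linearity of the first derivative, in the second because
  directional derivatives are holomorphic. Hence the four terms of \<open>levi_matrix\<close>
  cancel.\<close>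

lemma complex_hessian_Re_holo:
  assumes "holo_on h S" "open S" "z \<in> S"
  shows "Ck_on 2 (\<lambda>x. Re (h x)) S" and "complex_hessian (\<lambda>x. Re (h x)) z = 0"
proof -
  show C2: "Ck_on 2 (\<lambda>x. Re (h x)) S"
    by (rule Ck_on_bounded_linear[OF bounded_linear_Re assms(2) holo_on_imp_Ck_on[OF assms(2,1)]])
  let ?D = "\<lambda>z. frechet_derivative h (at z)"
  have D2: "((\<lambda>x. ?D x v) has_derivative snd_deriv h z v) (at z)" for v
    by (rule C2_on_has_snd_deriv[OF holo_on_imp_Ck_on[OF assms(2,1)] assms(3)])
  have left: "snd_deriv h z (c *s v) w = c * snd_deriv h z v w" for c v w
  proof (rule snd_deriv_eqI[OF assms(2,3)])
    show "(h has_derivative ?D x) (at x)" if "x \<in> S" for x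
      by (rule holo_on_has_derivative[OF assms(1) that])
    show "((\<lambda>x. ?D x (c *s v)) has_derivative (\<lambda>w. c * snd_deriv h z v w)) (at z)"
      by (rule has_derivative_transform_within_open[OF has_derivative_mult_right[OF D2] assms(2,3)])
         (simp add: holo_on_frechet_cmul[OF assms(1)])
  qed
  have right: "snd_deriv h z v (c *s w) = c * snd_deriv h z v w" for c v w
    unfolding snd_deriv_def
    by (rule holo_on_frechet_cmul[OF holo_on_directional_derivative[OF assms(2,1)] assms(3)])
  have "snd_deriv (\<lambda>x. Re (h x)) z v w = Re (snd_deriv h z v w)" for v w
    by (rule snd_deriv_eqI[OF assms(2,3), where D = "\<lambda>x v. Re (?D x v)"])
       (intro has_derivative_Re holo_on_has_derivative[OF assms(1)] D2, assumption,
        intro has_derivative_Re D2)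
  then have "snd_deriv (\<lambda>x. Re (h x)) z = (\<lambda>v w. Re (snd_deriv h z v w))" by blast
  moreover have "axis i \<i> = \<i> *s axis i (1::complex)" for i :: 'a
    by (simp add: vec_eq_iff axis_def)
  then have "snd_deriv h z (axis i \<i>) w = \<i> * snd_deriv h z (axis i 1) w"
    and "snd_deriv h z w (axis i \<i>) = \<i> * snd_deriv h z w (axis i 1)" for i w
    by (simp_all only: left right)
  ultimately have "levi_matrix (snd_deriv (\<lambda>x. Re (h x)) z) = 0"
    by (simp add: levi_matrix_def vec_eq_iff algebra_simps)
  then show "complex_hessian (\<lambda>x. Re (h x)) z = 0"
    by (simp add: complex_hessian_eq_levi[OF C2 assms(2,3)])
qed

section \<open>The maximum principle\<close>

lemma atlas_chart:
  assumes "complex_atlas X" "(U, \<phi>) \<in> X"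
  shows "open U" "continuous_on U \<phi>" "continuous_on (\<phi> ` U) (inv_into U \<phi>)"
    and "x \<in> U \<Longrightarrow> inv_into U \<phi> (\<phi> x) = x"
    and "open W \<Longrightarrow> open (\<phi> ` (U \<inter> W))"
    and "open T \<Longrightarrow> open (U \<inter> \<phi> -` T)"
proof -
  have op: "open U" "open (\<phi> ` U)" and hom: "homeomorphism U (\<phi> ` U) \<phi> (inv_into U \<phi>)"
    using assms unfolding complex_atlas_def by fast+
  show "open U" "continuous_on U \<phi>" "continuous_on (\<phi> ` U) (inv_into U \<phi>)"
    using op hom by (auto simp: homeomorphism_def)
  show "inv_into U \<phi> (\<phi> x) = x" if "x \<in> U" for x
    using hom that by (auto simp: homeomorphism_def)
  show "open (\<phi> ` (U \<inter> W))" if "open W" for W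
    using homeomorphism_imp_open_map[OF hom, of "U \<inter> W"] that op
    by (auto simp: openin_open_eq)
  show "open (U \<inter> \<phi> -` T)" if "open T" for T
    using \<open>continuous_on U \<phi>\<close> op(1) that by (rule continuous_open_preimage)
qed

lemma atlas_cover:
  assumes "complex_atlas X"
  obtains U \<phi> where "(U, \<phi>) \<in> X" "x \<in> U"
proof -
  have "x \<in> (\<Union>(U, \<phi>)\<in>X. U)" using assms by (simp add: complex_atlas_def)
  then show thesis using that by auto
qed

lemma atlas_transition:
  assumes "complex_atlas X" "(U, \<phi>) \<in> X" "(V, \<psi>) \<in> X"
  shows "holo_map_on (\<psi> \<circ> inv_into U \<phi>) (\<phi> ` (U \<inter> V))"
  using assms unfolding complex_atlas_def by fast

text \<open>Pseudoconvexity asks for a smooth witness, but \<open>g\<close> is only of class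
  \<open>C\<^sup>2\<close>. The quadratic minorant touching \<open>g\<close> at the maximum point
  inherits the maximum, and a small \<delta> does not reduce the number of positive
  eigenvalues.\<close>

lemma pseudoconvex_at_C2_local_max:
  fixes X :: "('x::t2_space, 'n::finite) chart set"
  assumes atlas: "complex_atlas X" and chart: "(U, \<phi>) \<in> X" "x \<in> U"
    and g: "Ck_on 2 g S" "open S" "\<phi> x \<in> S"
    and hess: "CARD('n) + 1 - p \<le> num_pos_eigenvalues (complex_hessian g (\<phi> x))"
    and W: "open W" "x \<in> W"
    and max: "\<And>y. y \<in> A \<Longrightarrow> y \<in> W \<Longrightarrow> y \<in> U \<Longrightarrow> \<phi> y \<in> S \<Longrightarrow> g (\<phi> y) \<le> g (\<phi> x)"
  shows "pseudoconvex_at X p A x"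
proof -
  let ?H = "complex_hessian g (\<phi> x)"
  obtain \<delta> where \<delta>: "\<delta> > 0"
    "num_pos_eigenvalues ?H \<le> num_pos_eigenvalues (?H - mat (of_real \<delta>))"
    using num_pos_eigenvalues_diff_mat by blast
  obtain Q r where Q: "r > 0" "ball (\<phi> x) r \<subseteq> S" "Q (\<phi> x) = g (\<phi> x)"
    "\<And>z. z \<in> ball (\<phi> x) r \<Longrightarrow> Q z \<le> g z"
    "\<And>k (h :: complex^'n \<Rightarrow> complex^'n) T. open T \<Longrightarrow> Ck_on k h T \<Longrightarrow> Ck_on k (\<lambda>x. Q (h x)) T"
    "\<And>z. complex_hessian Q z = ?H - mat (of_real \<delta>)"
    using C2_quadratic_minorant[OF g \<delta>(1)] by metis
  note U = atlas_chart[OF atlas chart(1)]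
  define \<omega> where "\<omega> = U \<inter> \<phi> -` ball (\<phi> x) r \<inter> W"
  have \<omega>: "open \<omega>" "x \<in> \<omega>" "\<omega> \<subseteq> U"
    using U(6)[OF open_ball] W chart(2) Q(1) by (auto simp: \<omega>_def)
  \<comment> \<open>In another chart this is \<open>Q\<close> after a transition map, which is
    smooth because it is holomorphic.\<close>
  have "mfd_smooth_on X (Q \<circ> \<phi>) \<omega>"
    unfolding mfd_smooth_on_def mfd_Ck_on_def
  proof (intro allI, clarify)
    fix k V \<psi> assume V: "(V, \<psi>) \<in> X"
    have "Ck_on k (\<phi> \<circ> inv_into V \<psi>) (\<psi> ` (V \<inter> U))"
      by (rule holo_map_on_imp_Ck_on[OF atlas_chart(5)[OF atlas V U(1)] atlas_transition[OF atlas V chart(1)]])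
    then have "Ck_on k (\<phi> \<circ> inv_into V \<psi>) (\<psi> ` (V \<inter> \<omega>))"
      by (rule Ck_on_subset) (use \<omega>(3) in auto)
    from Q(5)[OF atlas_chart(5)[OF atlas V \<omega>(1)] this]
    show "Ck_on k (Q \<circ> \<phi> \<circ> inv_into V \<psi>) (\<psi> ` (V \<inter> \<omega>))"
      by (simp add: o_def)
  qed
  moreover have "A \<inter> \<omega> \<subseteq> {y. (Q \<circ> \<phi>) y \<le> (Q \<circ> \<phi>) x}"
  proof clarify
    fix y assume y: "y \<in> A" "y \<in> \<omega>"
    then have "Q (\<phi> y) \<le> g (\<phi> y)" using Q(4) by (simp add: \<omega>_def)
    also have "\<dots> \<le> g (\<phi> x)" using max[of y] y Q(2) by (auto simp: \<omega>_def)
    finally show "(Q \<circ> \<phi>) y \<le> (Q \<circ> \<phi>) x" by (simp add: Q(3))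
  qed
  moreover have "hessian_pos_ge X (CARD('n) + 1 - p) (Q \<circ> \<phi>) x"
  proof -
    have op: "open (\<phi> ` U)" using U(5)[OF open_UNIV] by simp
    have "complex_hessian Q (\<phi> x) = complex_hessian (Q \<circ> \<phi> \<circ> inv_into U \<phi>) (\<phi> x)"
      by (rule complex_hessian_cong_open[OF Q(5)[OF op Ck_on_id[OF op]] op])
         (use chart(2) U(4) in auto)
    then show ?thesis
      unfolding hessian_pos_ge_def
      using chart order_trans[OF hess \<delta>(2)] Q(6) by force
  qed
  ultimately show ?thesis
    unfolding pseudoconvex_at_def using \<omega>(1,2) by blast
qed

section \<open>Germs satisfying the local maximum condition\<close>

text \<open>The exponent \<open>T \<circ> \<phi>\<close> has constant complex Hessian in its chart so that the number of positive
  eigenvalues does not change when the maximum point moves.\<close>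

definition test_max ::
  "('x::t2_space, 'n::finite) chart set \<Rightarrow> nat \<Rightarrow> 'x set \<Rightarrow> 'x \<Rightarrow> ('x \<Rightarrow> complex) \<Rightarrow> bool" where
  "test_max X m A x u \<longleftrightarrow> (\<exists>U \<phi> T H s W. (U, \<phi>) \<in> X \<and> x \<in> U \<and> Ck_on 2 T UNIV \<and>
     (\<forall>z. complex_hessian T z = H) \<and> m \<le> num_pos_eigenvalues H \<and> (0::real) < s \<and>
     open W \<and> x \<in> W \<and>
     (\<forall>y\<in>A \<inter> W \<inter> U. norm (u y) * exp (s * T (\<phi> y)) \<le> norm (u x) * exp (s * T (\<phi> x))))"

text \<open>The good germs of the introduction, with \<open>C\<close> in place of the closure of
  \<open>Psi X p A\<close>. Continuity is built in because \<open>germ_closure\<close> ranges only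
  over subsets of \<open>cont_germs A\<close>.\<close>

definition lmax_germs ::
  "('x::t2_space, 'n::finite) chart set \<Rightarrow> nat \<Rightarrow> 'x set \<Rightarrow> 'x set \<Rightarrow> 'x germ set" where
  "lmax_germs X m A C =
     {germ A x u | x u. (\<exists>U. openin (top_of_set A) U \<and> x \<in> U \<and> continuous_on U u) \<and>
        (u x \<noteq> 0 \<longrightarrow> test_max X m A x u \<longrightarrow> x \<in> C)}"

lemma germ_eqD:
  assumes "germ A x f = germ A y g" "x \<in> A"
  shows "x = y" "\<exists>W. open W \<and> x \<in> W \<and> (\<forall>z\<in>A \<inter> W. f z = g z)"
proof -
  show xy: "x = y" using assms(1) by (simp add: germ_def)
  have "f \<in> snd (germ A x f)"
    using assms(2) by (auto simp: germ_def intro!: exI[of _ A])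
  then have "f \<in> snd (germ A x g)" using assms(1) xy by simp
  then obtain U where U: "openin (top_of_set A) U" "x \<in> U" "\<forall>z\<in>U. f z = g z"
    by (auto simp: germ_def)
  then obtain W where "open W" "U = A \<inter> W" by (auto simp: openin_open)
  with U show "\<exists>W. open W \<and> x \<in> W \<and> (\<forall>z\<in>A \<inter> W. f z = g z)" by blast
qed

lemma test_max_germ_cong:
  assumes "germ A x f = germ A x g" "x \<in> A" "test_max X m A x f"
  shows "test_max X m A x g"
proof -
  obtain W0 where W0: "open W0" "x \<in> W0" "\<forall>z\<in>A \<inter> W0. f z = g z"
    using germ_eqD(2)[OF assms(1,2)] by blast
  obtain U \<phi> T H s W where *: "(U, \<phi>) \<in> X" "x \<in> U" "Ck_on 2 T UNIV"
     "\<forall>z. complex_hessian T z = H" "m \<le> num_pos_eigenvalues H" "(0::real) < s"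
     "open W" "x \<in> W"
     "\<forall>y\<in>A \<inter> W \<inter> U. norm (f y) * exp (s * T (\<phi> y)) \<le> norm (f x) * exp (s * T (\<phi> x))"
    using assms(3) unfolding test_max_def by blast
  have "open (W \<inter> W0)" "x \<in> W \<inter> W0" using * W0 by auto
  moreover have "\<forall>y\<in>A \<inter> (W \<inter> W0) \<inter> U.
      norm (g y) * exp (s * T (\<phi> y)) \<le> norm (g x) * exp (s * T (\<phi> x))"
  proof
    fix y assume y: "y \<in> A \<inter> (W \<inter> W0) \<inter> U"
    then have "f y = g y" "f x = g x" using W0 assms(2) by auto
    then show "norm (g y) * exp (s * T (\<phi> y)) \<le> norm (g x) * exp (s * T (\<phi> x))"
      using bspec[OF *(9), of y] y by simp
  qed
  ultimately show ?thesis
    unfolding test_max_def using *(1-6) by blast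
qed

text \<open>The definition only provides some representative of the germ; since
  \<open>test_max\<close> depends on the germ alone, the condition passes to every
  representative.\<close>

lemma lmax_germsD:
  assumes "germ A x f \<in> lmax_germs X m A C" "x \<in> A" "f x \<noteq> 0" "test_max X m A x f"
  shows "x \<in> C"
proof -
  obtain y u where u: "germ A x f = germ A y u" "u y \<noteq> 0 \<longrightarrow> test_max X m A y u \<longrightarrow> y \<in> C"
    using assms(1) unfolding lmax_germs_def by blast
  have xy: "x = y" using germ_eqD(1)[OF u(1) assms(2)] .
  then have "f x = u x" using germ_eqD(2)[OF u(1) assms(2)] assms(2) by auto
  then show ?thesis
    using u assms test_max_germ_cong[of A x f u X m] xy by simp
qed

lemma lmax_germs_subset_cont_germs: "lmax_germs X m A C \<subseteq> cont_germs A"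
  unfolding lmax_germs_def cont_germs_def by blast

text \<open>Dividing by \<open>G a\<close> moves the value at \<open>a\<close> to 1, away from the
  branch cut, so the principal logarithm works near \<open>a\<close>.\<close>

lemma holo_on_Ln_quotient:
  assumes "holo_on G S" "open S" "a \<in> S" "G a \<noteq> 0"
  obtains S' h where "open S'" "a \<in> S'" "S' \<subseteq> S" "holo_on h S'" "h a = 0"
    "\<And>z. z \<in> S' \<Longrightarrow> G z = G a * exp (h z)"
proof -
  define q where "q z = G z / G a" for z
  define S' where "S' = S \<inter> q -` (- \<real>\<^sub>\<le>\<^sub>0)"
  have q: "(q has_derivative (\<lambda>v. frechet_derivative G (at z) v / G a)) (at z)" if "z \<in> S" for z
    unfolding q_def
    by (rule bounded_linear.has_derivative[OF bounded_linear_divide holo_on_has_derivative[OF assms(1) that]])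
  have cont: "continuous_on S q"
    unfolding q_def using holo_on_imp_continuous_on[OF assms(1)] assms(4) by (intro continuous_intros) auto
  show thesis
  proof (rule that[of S' "\<lambda>z. Ln (q z)"])
    show "open S'"
      unfolding S'_def using cont assms(2)
      by (rule continuous_open_preimage) (simp add: open_Compl closed_nonpos_Reals_complex)
    show "a \<in> S'" "Ln (q a) = 0" using assms(3,4) by (auto simp: S'_def q_def)
    show "S' \<subseteq> S" by (auto simp: S'_def)
    show "G z = G a * exp (Ln (q z))" if "z \<in> S'" for z
    proof -
      have "q z \<noteq> 0" using that by (auto simp: S'_def)
      then show ?thesis using assms(4) by (simp add: q_def)
    qed
    show "holo_on (\<lambda>z. Ln (q z)) S'"
      unfolding holo_on_def
    proof
      fix z assume z: "z \<in> S'"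
      have "(Ln has_derivative (*) (inverse (q z))) (at (q z))"
        using z has_field_derivative_Ln[of "q z"] by (simp add: S'_def has_field_derivative_def)
      from diff_chain_at[OF q this] z
      have "((\<lambda>z. Ln (q z)) has_derivative
          (\<lambda>v. inverse (q z) * (frechet_derivative G (at z) v / G a))) (at z)"
        by (simp add: o_def S'_def)
      then show "\<exists>D. ((\<lambda>z. Ln (q z)) has_derivative D) (at z) \<and> (\<forall>c v. D (c *s v) = c * D v)"
        by (intro exI, rule conjI) (use z in \<open>simp add: holo_on_frechet_cmul[OF assms(1)] S'_def\<close>)
    qed
  qed
qed

text \<open>Near a maximum of \<open>|F| e\<^bsup>s T\<^esup>\<close>, the function \<open>ln |F| / s + T\<close> has the complex Hessian of \<open>T\<close>, since
  \<open>ln |F|\<close> is the real part of a branch of \<open>ln F\<close>.\<close>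

lemma holo_test_max_imp_pseudoconvex:
  fixes X :: "('x::t2_space, 'n::finite) chart set"
  assumes atlas: "complex_atlas X" and F: "mfd_holo_on X F W0" "open W0" "x \<in> W0" "F x \<noteq> 0"
    and test: "test_max X (CARD('n) + 1 - p) A x F"
  shows "pseudoconvex_at X p A x"
proof -
  obtain U \<phi> T H s W where *: "(U, \<phi>) \<in> X" "x \<in> U" "Ck_on 2 T UNIV"
     "\<And>z. complex_hessian T z = H" "CARD('n) + 1 - p \<le> num_pos_eigenvalues H" "(0::real) < s"
     "open W" "x \<in> W"
     "\<And>y. y \<in> A \<inter> W \<inter> U \<Longrightarrow> norm (F y) * exp (s * T (\<phi> y)) \<le> norm (F x) * exp (s * T (\<phi> x))"
    using test unfolding test_max_def by blast
  note U = atlas_chart[OF atlas *(1)]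
  have "holo_on (F \<circ> inv_into U \<phi>) (\<phi> ` (U \<inter> W0))"
    using F(1) *(1) unfolding mfd_holo_on_def by fast
  moreover have "\<phi> x \<in> \<phi> ` (U \<inter> W0)" using *(2) F(3) by blast
  moreover have "(F \<circ> inv_into U \<phi>) (\<phi> x) \<noteq> 0" using U(4) *(2) F(4) by simp
  ultimately obtain S h where h: "open S" "\<phi> x \<in> S" "S \<subseteq> \<phi> ` (U \<inter> W0)" "holo_on h S" "h (\<phi> x) = 0"
    "\<And>z. z \<in> S \<Longrightarrow> (F \<circ> inv_into U \<phi>) z = (F \<circ> inv_into U \<phi>) (\<phi> x) * exp (h z)"
    using holo_on_Ln_quotient[OF _ U(5)[OF F(2)]] by metis
  have hs: "holo_on (\<lambda>z. h z / s) S"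
    unfolding holo_on_def
  proof
    fix z assume z: "z \<in> S"
    show "\<exists>D. ((\<lambda>z. h z / s) has_derivative D) (at z) \<and> (\<forall>c v. D (c *s v) = c * D v)"
      by (rule exI, rule conjI, rule bounded_linear.has_derivative[OF bounded_linear_divide
            holo_on_has_derivative[OF h(4) z]]) (simp add: holo_on_frechet_cmul[OF h(4) z])
  qed
  \<comment> \<open>Up to a constant this is the logarithm of the tested function divided by
    \<open>s\<close>, so it has the same maximum; the first summand is pluriharmonic.\<close>
  define g where "g z = Re (h z / s) + T z" for z
  have T: "Ck_on 2 T S" using Ck_on_subset[OF *(3)] by blast
  have g: "Ck_on 2 g S" "complex_hessian g (\<phi> x) = H"
    unfolding g_def
    using Ck_on_add[OF h(1) complex_hessian_Re_holo(1)[OF hs h(1,2)] T]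
      complex_hessian_add[OF complex_hessian_Re_holo(1)[OF hs h(1,2)] T h(1,2)]
      complex_hessian_Re_holo(2)[OF hs h(1,2)] *(4) by simp_all
  show ?thesis
  proof (rule pseudoconvex_at_C2_local_max[OF atlas *(1,2) g(1) h(1,2) _ *(7,8)])
    show "CARD('n) + 1 - p \<le> num_pos_eigenvalues (complex_hessian g (\<phi> x))"
      using *(5) g(2) by simp
    fix y assume y: "y \<in> A" "y \<in> W" "y \<in> U" "\<phi> y \<in> S"
    have "F y = F x * exp (h (\<phi> y))" using h(6)[OF y(4)] U(4) y *(2) by simp
    then have "norm (F x) * (exp (Re (h (\<phi> y))) * exp (s * T (\<phi> y))) \<le> norm (F x) * exp (s * T (\<phi> x))"
      using *(9)[of y] y by (simp add: norm_mult)
    then have "Re (h (\<phi> y)) + s * T (\<phi> y) \<le> s * T (\<phi> x)"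
      using F(4) by (simp flip: exp_add)
    then have "s * g (\<phi> y) \<le> s * g (\<phi> x)"
      using *(6) h(5) by (simp add: g_def distrib_left)
    then show "g (\<phi> y) \<le> g (\<phi> x)" using *(6) by simp
  qed
qed

lemma holo_germs_subset_lmax_germs:
  fixes X :: "('x::t2_space, 'n::finite) chart set"
  assumes atlas: "complex_atlas X"
  shows "holo_germs X A \<subseteq> lmax_germs X (CARD('n) + 1 - p) A (closure (Psi X p A))"
proof
  fix G assume "G \<in> holo_germs X A"
  then obtain x F W where F: "G = germ A x F" "x \<in> A" "open W" "x \<in> W" "mfd_holo_on X F W"
    unfolding holo_germs_def by blast
  obtain U \<phi> where U: "(U, \<phi>) \<in> X" "x \<in> U"
    using atlas_cover[OF atlas] .
  note ch = atlas_chart[OF atlas U(1)]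
  have "holo_on (F \<circ> inv_into U \<phi>) (\<phi> ` (U \<inter> W))"
    using F(5) U(1) unfolding mfd_holo_on_def by fast
  then have "continuous_on (U \<inter> W) (\<lambda>y. (F \<circ> inv_into U \<phi>) (\<phi> y))"
    by (rule continuous_on_compose2[OF holo_on_imp_continuous_on continuous_on_subset[OF ch(2)]]) auto
  then have "continuous_on (U \<inter> W) F"
    by (rule continuous_on_eq) (simp add: ch(4))
  then have "continuous_on (A \<inter> (U \<inter> W)) F"
    by (rule continuous_on_subset) auto
  moreover have "openin (top_of_set A) (A \<inter> (U \<inter> W))" "x \<in> A \<inter> (U \<inter> W)"
    using F U ch(1) by (auto simp: openin_open)
  moreover have "x \<in> closure (Psi X p A)" if "F x \<noteq> 0" "test_max X (CARD('n) + 1 - p) A x F"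
  proof -
    have "x \<in> Psi X p A"
      using holo_test_max_imp_pseudoconvex[OF atlas F(5,3,4) that] F(2) by (simp add: Psi_def)
    then show ?thesis using closure_subset by blast
  qed
  ultimately show "G \<in> lmax_germs X (CARD('n) + 1 - p) A (closure (Psi X p A))"
    unfolding lmax_germs_def F(1) by blast
qed

text \<open>Subtracting \<open>\<delta> |z - a|\<^sup>2\<close> from the exponent makes the maximum of the limit function strict, so nearby
  approximants have maxima of the same kind close to it.\<close>

lemma lmax_germs_limit:
  fixes X :: "('x::t2_space, 'n::finite) chart set"
  assumes atlas: "complex_atlas X" and A: "closed A" and C: "closed C"
    and V: "openin (top_of_set A) V" "x \<in> V"
    and u: "\<And>k::nat. u k \<in> sections A (lmax_germs X m A C) V"
    and lim: "\<And>K. compact K \<Longrightarrow> K \<subseteq> V \<Longrightarrow> uniform_limit K u f sequentially"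
    and f: "f x \<noteq> 0" "test_max X m A x f"
  shows "x \<in> C"
proof (rule ccontr)
  assume "x \<notin> C"
  obtain V' where V': "open V'" "V = A \<inter> V'" using V(1) by (auto simp: openin_open)
  obtain U \<phi> T H s W where *: "(U, \<phi>) \<in> X" "x \<in> U" "Ck_on 2 T UNIV"
     "\<And>z. complex_hessian T z = H" "m \<le> num_pos_eigenvalues H" "(0::real) < s"
     "open W" "x \<in> W"
     "\<And>y. y \<in> A \<inter> W \<inter> U \<Longrightarrow> norm (f y) * exp (s * T (\<phi> y)) \<le> norm (f x) * exp (s * T (\<phi> x))"
    using f(2) unfolding test_max_def by blast
  note ch = atlas_chart[OF atlas *(1)]
  obtain \<delta> where \<delta>: "\<delta> > 0"
    "num_pos_eigenvalues H \<le> num_pos_eigenvalues (H - mat (of_real \<delta>))"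
    using num_pos_eigenvalues_diff_mat by blast
  define a where "a = \<phi> x"
  define T' where "T' z = T z - \<delta> * (norm (z - a))\<^sup>2" for z
  have T': "Ck_on 2 T' UNIV" "\<And>z. complex_hessian T' z = H - mat (of_real \<delta>)"
    unfolding T'_def using complex_hessian_diff_norm[OF *(3)] *(4) by simp_all
  have contT': "continuous_on Z T'" for Z
    using continuous_on_subset[OF Ck_on_imp_continuous_on[OF T'(1)]] by blast
  \<comment> \<open>Removing \<open>C\<close> here makes any maximum of an approximant found in
    \<open>G\<close> contradict its goodness.\<close>
  define G where "G = U \<inter> (W \<inter> V' \<inter> - C)"
  have G: "open (\<phi> ` G)" "a \<in> \<phi> ` G"
    using ch(5)[of "W \<inter> V' \<inter> - C"] *(2,7,8) V(2) V' C \<open>x \<notin> C\<close> by (auto simp: G_def a_def)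
  obtain r where r: "r > 0" "cball a r \<subseteq> \<phi> ` G" using open_contains_cball G by blast
  define K where "K = {y \<in> A \<inter> G. \<phi> y \<in> cball a r}"
  have "K = A \<inter> inv_into U \<phi> ` cball a r"
  proof (intro equalityI subsetI)
    show "y \<in> A \<inter> inv_into U \<phi> ` cball a r" if "y \<in> K" for y
      using that ch(4)[of y] by (auto simp: K_def G_def intro!: image_eqI[of _ _ "\<phi> y"])
    fix y assume y: "y \<in> A \<inter> inv_into U \<phi> ` cball a r"
    then obtain z where z: "y = inv_into U \<phi> z" "z \<in> cball a r" by blast
    then obtain y' where "y' \<in> G" "z = \<phi> y'" using r(2) by blast
    then show "y \<in> K" using y z ch(4)[of y'] by (simp add: K_def G_def)
  qed
  moreover have "compact (inv_into U \<phi> ` cball a r)"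
    using r(2) by (intro compact_continuous_image continuous_on_subset[OF ch(3)]) (auto simp: G_def)
  ultimately have "compact K" using A by (simp add: closed_Int_compact)
  have KV: "K \<subseteq> V" "K \<subseteq> U" by (auto simp: K_def G_def V'(2))
  have xK: "x \<in> K" using V V' *(2,8) \<open>x \<notin> C\<close> r(1) by (auto simp: K_def G_def a_def)
  have "compact (T' ` cball a r)" by (intro compact_continuous_image contT' compact_cball)
  then obtain b where b: "\<And>z. z \<in> cball a r \<Longrightarrow> T' z \<le> b"
    using compact_imp_bounded bounded_imp_bdd_above unfolding bdd_above_def by (metis imageI)
  define B where "B = exp (s * b)"
  have B: "B > 0" "\<And>y. y \<in> K \<Longrightarrow> exp (s * T' (\<phi> y)) \<le> B"
    using b *(6) by (auto simp: B_def K_def)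
  define w where "w v y = norm (v y) * exp (s * T' (\<phi> y))" for v :: "'x \<Rightarrow> complex" and y
  \<comment> \<open>The factor by which the lowered exponent pushes the weighted limit function on
    the bounding sphere below its value at \<open>x\<close>.\<close>
  define q where "q = exp (- (s * \<delta> * r\<^sup>2))"
  have q: "q < 1" "q > 0" using *(6) \<delta>(1) r(1) by (auto simp: q_def)
  have wx: "w f x > 0" using f(1) by (simp add: w_def)
  \<comment> \<open>Chosen so that twice the weighted error \<open>\<eta> * B\<close> is half of the
    drop \<open>w f x * (1 - q)\<close>.\<close>
  define \<eta> where "\<eta> = w f x * (1 - q) / (4 * B)"
  have \<eta>: "\<eta> > 0" using wx q B(1) by (simp add: \<eta>_def)
  have \<eta>B: "2 * (\<eta> * B) < w f x * (1 - q)"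
    using B(1) mult_pos_pos[OF wx, of "1 - q"] q wx by (simp add: \<eta>_def)
  have "eventually (\<lambda>k. \<forall>y\<in>K. dist (u k y) (f y) < \<eta>) sequentially"
    using uniform_limitD[OF lim[OF \<open>compact K\<close> KV(1)] \<eta>] .
  then obtain k where k: "\<And>y. y \<in> K \<Longrightarrow> dist (u k y) (f y) < \<eta>"
    unfolding eventually_sequentially by blast
  define g where "g = u k"
  have close: "\<bar>w g y - w f y\<bar> \<le> \<eta> * B" if "y \<in> K" for y
  proof -
    have "\<bar>norm (g y) - norm (f y)\<bar> \<le> \<eta>"
      using k[OF that] norm_triangle_ineq3[of "g y" "f y"] by (simp add: g_def dist_norm)
    then have "\<bar>norm (g y) - norm (f y)\<bar> * exp (s * T' (\<phi> y)) \<le> \<eta> * B"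
      using B(2)[OF that] \<eta> by (intro mult_mono) auto
    then show ?thesis by (simp add: w_def abs_mult flip: left_diff_distrib)
  qed
  have decay: "w f y \<le> w f x * exp (- (s * \<delta> * (norm (\<phi> y - a))\<^sup>2))" if "y \<in> K" for y
  proof -
    have "w f y = norm (f y) * exp (s * T (\<phi> y)) * exp (- (s * \<delta> * (norm (\<phi> y - a))\<^sup>2))"
      by (simp add: w_def T'_def algebra_simps flip: exp_add)
    also have "\<dots> \<le> norm (f x) * exp (s * T (\<phi> x)) * exp (- (s * \<delta> * (norm (\<phi> y - a))\<^sup>2))"
      using *(9)[of y] that by (intro mult_right_mono) (auto simp: K_def G_def)
    finally show ?thesis by (simp add: w_def T'_def a_def)
  qed
  have contg: "continuous_on V g" and germg: "\<And>y. y \<in> V \<Longrightarrow> germ A y g \<in> lmax_germs X m A C"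
    using u[of k] by (auto simp: sections_def g_def)
  have "continuous_on K (w g)"
    unfolding w_def
    by (intro continuous_intros continuous_on_subset[OF contg KV(1)]
        continuous_on_compose2[OF contT'[of UNIV] continuous_on_subset[OF ch(2) KV(2)]]) auto
  then obtain y where y: "y \<in> K" "\<And>z. z \<in> K \<Longrightarrow> w g z \<le> w g y"
    using continuous_attains_sup[OF \<open>compact K\<close>] xK by blast
  have big: "w f x - \<eta> * B \<le> w g y"
    using y(2)[OF xK] close[OF xK] by linarith
  \<comment> \<open>A maximum on the sphere would force the drop there to be at most twice the
    approximation error.\<close>
  have interior: "\<phi> y \<in> ball a r"
  proof (rule ccontr)
    assume "\<phi> y \<notin> ball a r"
    then have "norm (\<phi> y - a) = r"
      using y(1) by (simp add: K_def dist_norm norm_minus_commute)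
    then have "w f y \<le> w f x * q" using decay[OF y(1)] by (simp add: q_def)
    then have "w f x - w f x * q \<le> 2 * (\<eta> * B)"
      using big close[OF y(1)] by linarith
    then show False using \<eta>B by (simp add: right_diff_distrib)
  qed
  have "g y \<noteq> 0"
  proof
    assume "g y = 0"
    then have "w f x \<le> \<eta> * B" using big by (simp add: w_def)
    moreover have "w f x * (1 - q) \<le> w f x" using wx q by (simp add: mult_left_le)
    moreover have "\<eta> * B > 0" using \<eta> B(1) by simp
    ultimately show False using \<eta>B by linarith
  qed
  moreover have "test_max X m A y g"
  proof -
    let ?W = "U \<inter> \<phi> -` ball a r \<inter> (W \<inter> V' \<inter> - C)"
    have "open ?W" by (rule open_Int[OF ch(6)[OF open_ball] open_Int[OF open_Int[OF *(7) V'(1)] open_Compl[OF C]]])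
    moreover have "y \<in> ?W" using y(1) interior by (auto simp: K_def G_def)
    moreover have "norm (g z) * exp (s * T' (\<phi> z)) \<le> norm (g y) * exp (s * T' (\<phi> y))"
      if "z \<in> A \<inter> ?W \<inter> U" for z
      using y(2)[of z] that by (auto simp: w_def K_def G_def)
    moreover have "m \<le> num_pos_eigenvalues (H - mat (of_real \<delta>))"
      using *(5) \<delta>(2) by linarith
    ultimately show ?thesis
      unfolding test_max_def using *(1,6) T' KV(2) y(1) by blast
  qed
  ultimately have "y \<in> C"
    using lmax_germsD[OF germg] y(1) KV(1) V'(2) by blast
  then show False using y(1) by (simp add: K_def G_def)
qed

lemma germ_limits_lmax_germs:
  assumes "complex_atlas X" "closed A" "closed C"
  shows "germ_limits A (lmax_germs X m A C) \<subseteq> lmax_germs X m A C"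
proof
  fix G assume "G \<in> germ_limits A (lmax_germs X m A C)"
  then obtain x f V s where *: "G = germ A x f" "openin (top_of_set A) V" "x \<in> V" "continuous_on V f"
    "\<And>k::nat. s k \<in> sections A (lmax_germs X m A C) V"
    "\<And>K. compact K \<Longrightarrow> K \<subseteq> V \<Longrightarrow> uniform_limit K s f sequentially"
    unfolding germ_limits_def by (elim CollectE exE conjE) (rule that; blast)
  then show "G \<in> lmax_germs X m A C"
    using lmax_germs_limit[OF assms *(2,3,5,6)] unfolding lmax_germs_def by blast
qed

text \<open>\<open>germ_closure\<close> is an intersection, so it suffices that the good germs form
  one of the intersected sets: they are continuous, contain the holomorphic germs and are stable
  under limits.\<close>

lemma lacr_germs_subset_lmax_germs:
  fixes X :: "('x::t2_space, 'n::finite) chart set"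
  assumes "complex_atlas X" "closed A"
  shows "lacr_germs X A \<subseteq> lmax_germs X (CARD('n) + 1 - p) A (closure (Psi X p A))"
  unfolding lacr_germs_def germ_closure_def
  using lmax_germs_subset_cont_germs holo_germs_subset_lmax_germs[OF assms(1)]
    germ_limits_lmax_germs[OF assms closed_closure]
  by (intro Inter_lower) blast

section \<open>Nonemptiness of the pseudoconvex set and the global maximum principle\<close>

lemma Psi_nonempty:
  fixes X :: "('x::t2_space, 'n::finite) chart set"
  assumes atlas: "complex_atlas X" and f: "mfd_Ck_on X 2 f UNIV"
    and hess: "\<And>x. hessian_pos_ge X (CARD('n) + 1 - p) f x"
    and contf: "continuous_on A f" and A: "compact A" "A \<noteq> {}"
  shows "Psi X p A \<noteq> {}"
proof -
  obtain x where x: "x \<in> A" "\<And>y. y \<in> A \<Longrightarrow> f y \<le> f x"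
    using continuous_attains_sup[OF A contf] by blast
  obtain U \<phi> where U: "(U, \<phi>) \<in> X" "x \<in> U"
    "CARD('n) + 1 - p \<le> num_pos_eigenvalues (complex_hessian (f \<circ> inv_into U \<phi>) (\<phi> x))"
    using hess[of x] unfolding hessian_pos_ge_def by blast
  note ch = atlas_chart[OF atlas U(1)]
  have "Ck_on 2 (f \<circ> inv_into U \<phi>) (\<phi> ` U)"
    using f U(1) unfolding mfd_Ck_on_def by fastforce
  then have "pseudoconvex_at X p A x"
    by (rule pseudoconvex_at_C2_local_max[OF atlas U(1,2) _ _ _ U(3) open_UNIV])
       (use ch(4) ch(5)[OF open_UNIV] U(2) x(2) in auto)
  then show ?thesis using x(1) by (auto simp: Psi_def)
qed

lemma mfd_C2_continuous:
  assumes atlas: "complex_atlas X" and f: "mfd_Ck_on X 2 f UNIV"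
  shows "continuous_on A f"
proof (rule continuous_at_imp_continuous_on, rule ballI)
  fix x
  obtain U \<phi> where U: "(U, \<phi>) \<in> X" "x \<in> U"
    using atlas_cover[OF atlas] .
  note ch = atlas_chart[OF atlas U(1)]
  have "Ck_on 2 (f \<circ> inv_into U \<phi>) (\<phi> ` U)"
    using f U(1) unfolding mfd_Ck_on_def by fastforce
  then have "continuous_on U (\<lambda>y. (f \<circ> inv_into U \<phi>) (\<phi> y))"
    by (rule continuous_on_compose2[OF Ck_on_imp_continuous_on ch(2)]) simp
  then have "continuous_on U f" by (rule continuous_on_eq) (simp add: ch(4))
  then show "isCont f x" using U(2) ch(1) by (simp add: continuous_on_eq_continuous_at)
qed

text \<open>The weight with exponent \<open>\<epsilon> * f\<close> supplies the positive
  eigenvalues, and a small \<epsilon> keeps its maximum point where \<open>u\<close> exceeds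
  \<sigma>. That point lies off the closure of \<open>Psi X p A\<close>, against goodness of the
  germ of \<open>u\<close>.\<close>

lemma lacr_maximum_principle:
  fixes X :: "('x::t2_space, 'n::finite) chart set" and u :: "'x \<Rightarrow> complex"
  assumes atlas: "complex_atlas X" and f: "mfd_Ck_on X 2 f UNIV"
    and hess: "\<And>x. hessian_pos_ge X (CARD('n) + 1 - p) f x"
    and A: "compact A" and cont: "continuous_on A u"
    and u: "u \<in> sections A (lacr_germs X A) (A - closure (Psi X p A))"
    and \<sigma>: "0 \<le> \<sigma>" "\<And>y. y \<in> Psi X p A \<Longrightarrow> norm (u y) \<le> \<sigma>" and x: "x \<in> A"
  shows "norm (u x) \<le> \<sigma>"
proof (rule ccontr)
  assume "\<not> norm (u x) \<le> \<sigma>"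
  define \<kappa> where "\<kappa> = norm (u x)"
  have \<kappa>: "\<sigma> < \<kappa>" "\<kappa> > 0" using \<open>\<not> norm (u x) \<le> \<sigma>\<close> \<sigma>(1) by (auto simp: \<kappa>_def)
  have clA: "closed A" by (rule compact_imp_closed[OF A])
  have "closed (A \<inter> (\<lambda>y. norm (u y)) -` {..\<sigma>})"
    by (intro continuous_closed_preimage continuous_intros cont clA closed_atMost)
  \<comment> \<open>Continuity of \<open>u\<close> on the closed set \<open>A\<close> carries the
    bound \<sigma> over to the closure.\<close>
  then have "closure (Psi X p A) \<subseteq> A \<inter> (\<lambda>y. norm (u y)) -` {..\<sigma>}"
    by (rule closure_minimal[rotated]) (use \<sigma>(2) in \<open>auto simp: Psi_def\<close>)
  then have clPsi: "norm (u y) \<le> \<sigma>" if "y \<in> closure (Psi X p A)" for y using that by blast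
  have contf: "continuous_on A f" by (rule mfd_C2_continuous[OF atlas f])
  have "bounded (f ` A)" by (intro compact_imp_bounded compact_continuous_image contf A)
  then obtain c where c: "c > 0" "\<And>y. y \<in> A \<Longrightarrow> \<bar>f y\<bar> \<le> c"
    unfolding bounded_pos by auto
  \<comment> \<open>Half of the relative gap between \<sigma> and \<kappa>. As \<open>f\<close>
    varies by at most \<open>2 * c\<close> on \<open>A\<close>, the next choice of \<epsilon> lets
    the exponent vary by at most \<open>t\<close>.\<close>
  define t where "t = (1 - \<sigma> / \<kappa>) / 2"
  have t: "t > 0" "\<sigma> / \<kappa> < 1 - t" using \<kappa> by (auto simp: t_def field_simps)
  define \<epsilon> where "\<epsilon> = t / (2 * c)"
  have \<epsilon>: "\<epsilon> > 0" using t(1) c(1) by (simp add: \<epsilon>_def)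
  have "continuous_on A (\<lambda>y. norm (u y) * exp (\<epsilon> * f y))"
    by (intro continuous_intros cont contf)
  then obtain x0 where x0: "x0 \<in> A"
    "\<And>y. y \<in> A \<Longrightarrow> norm (u y) * exp (\<epsilon> * f y) \<le> norm (u x0) * exp (\<epsilon> * f x0)"
    using continuous_attains_sup[OF A] x by blast
  have "\<sigma> < norm (u x0)"
  proof -
    have "\<epsilon> * (f x0 - f x) \<le> \<epsilon> * (2 * c)"
      using c(2)[OF x] c(2)[OF x0(1)] \<epsilon> by (intro mult_left_mono) auto
    also have "\<dots> = t" using c(1) by (simp add: \<epsilon>_def)
    finally have "1 - t \<le> exp (\<epsilon> * (f x - f x0))"
      using exp_ge_add_one_self[of "\<epsilon> * (f x - f x0)"] unfolding right_diff_distrib by linarith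
    then have "\<sigma> / \<kappa> < exp (\<epsilon> * (f x - f x0))" using t(2) by linarith
    then have "\<sigma> < \<kappa> * exp (\<epsilon> * (f x - f x0))" using \<kappa>(2) by (simp add: field_simps)
    also have "\<dots> = \<kappa> * exp (\<epsilon> * f x) * exp (- (\<epsilon> * f x0))"
      by (simp add: right_diff_distrib exp_diff exp_minus field_simps)
    also have "\<dots> \<le> norm (u x0) * exp (\<epsilon> * f x0) * exp (- (\<epsilon> * f x0))"
      using x0(2)[OF x] by (intro mult_right_mono) (auto simp: \<kappa>_def)
    also have "\<dots> = norm (u x0)" by (simp add: exp_minus)
    finally show ?thesis .
  qed
  then have nz: "u x0 \<noteq> 0" and out: "x0 \<notin> closure (Psi X p A)" using \<sigma>(1) clPsi by force+
  obtain U \<phi> where U: "(U, \<phi>) \<in> X" "x0 \<in> U"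
    "CARD('n) + 1 - p \<le> num_pos_eigenvalues (complex_hessian (f \<circ> inv_into U \<phi>) (\<phi> x0))"
    using hess[of x0] unfolding hessian_pos_ge_def by blast
  note ch = atlas_chart[OF atlas U(1)]
  let ?g = "f \<circ> inv_into U \<phi>"
  let ?H = "complex_hessian ?g (\<phi> x0)"
  have g: "Ck_on 2 ?g (\<phi> ` U)" "open (\<phi> ` U)" "\<phi> x0 \<in> \<phi> ` U"
    using f U ch(5)[OF open_UNIV] unfolding mfd_Ck_on_def by fastforce+
  obtain \<delta> where \<delta>: "\<delta> > 0"
    "num_pos_eigenvalues ?H \<le> num_pos_eigenvalues (?H - mat (of_real \<delta>))"
    using num_pos_eigenvalues_diff_mat by blast
  obtain Q r where Q: "r > 0" "ball (\<phi> x0) r \<subseteq> \<phi> ` U" "Q (\<phi> x0) = ?g (\<phi> x0)"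
    "\<And>z. z \<in> ball (\<phi> x0) r \<Longrightarrow> Q z \<le> ?g z"
    "\<And>k (h :: complex^'n \<Rightarrow> complex^'n) T. open T \<Longrightarrow> Ck_on k h T \<Longrightarrow> Ck_on k (\<lambda>x. Q (h x)) T"
    "\<And>z. complex_hessian Q z = ?H - mat (of_real \<delta>)"
    using C2_quadratic_minorant[OF g \<delta>(1)] by metis
  \<comment> \<open>The Hessian of \<open>f\<close> in the chart may vary, whereas
    \<open>test_max\<close> wants a constant one. The minorant \<open>Q\<close> has it, and
    agreement with \<open>f\<close> at \<open>x0\<close> preserves the maximum.\<close>
  have "test_max X (CARD('n) + 1 - p) A x0 u"
  proof -
    let ?W = "U \<inter> \<phi> -` ball (\<phi> x0) r"
    have "norm (u y) * exp (\<epsilon> * Q (\<phi> y)) \<le> norm (u x0) * exp (\<epsilon> * Q (\<phi> x0))"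
      if y: "y \<in> A \<inter> ?W \<inter> U" for y
    proof -
      have "Q (\<phi> y) \<le> f y" using Q(4)[of "\<phi> y"] y ch(4) by simp
      then have "norm (u y) * exp (\<epsilon> * Q (\<phi> y)) \<le> norm (u y) * exp (\<epsilon> * f y)"
        using \<epsilon> by (intro mult_left_mono) auto
      also have "\<dots> \<le> norm (u x0) * exp (\<epsilon> * f x0)" using x0(2) y by blast
      finally show ?thesis using Q(3) ch(4)[OF U(2)] by simp
    qed
    moreover have "open ?W" "x0 \<in> ?W" using ch(6)[OF open_ball] U(2) Q(1) by auto
    moreover have "Ck_on 2 Q UNIV" using Q(5)[OF open_UNIV Ck_on_id[OF open_UNIV]] by simp
    moreover have "CARD('n) + 1 - p \<le> num_pos_eigenvalues (?H - mat (of_real \<delta>))"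
      using U(3) \<delta>(2) by linarith
    ultimately show ?thesis
      unfolding test_max_def using U(1,2) Q(6) \<epsilon> by blast
  qed
  moreover have "germ A x0 u \<in> lmax_germs X (CARD('n) + 1 - p) A (closure (Psi X p A))"
    using u x0(1) out lacr_germs_subset_lmax_germs[OF atlas clA] by (auto simp: sections_def)
  ultimately have "x0 \<in> closure (Psi X p A)"
    using lmax_germsD x0(1) nz by blast
  then show False using out by blast
qed

theorem theorem4p3:
  fixes X :: "('x::t2_space, 'n::finite) chart set"
    and A :: "'x set" and p :: nat
  assumes "p > 0"
    and "complex_atlas X"
    and "\<exists>f :: 'x \<Rightarrow> real. mfd_Ck_on X 2 f UNIV \<and>
           (\<forall>x. hessian_pos_ge X (CARD('n) + 1 - p) f x)"
    and "compact A" and "A \<noteq> {}"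
  shows "Psi X p A \<noteq> {} \<and>
    (\<forall>x\<in>A. \<forall>u. continuous_on A u \<and>
         u \<in> sections A (lacr_germs X A) (A - closure (Psi X p A)) \<longrightarrow>
       norm (u x) \<le> (SUP y\<in>Psi X p A. norm (u y)))"
proof -
  obtain f :: "'x \<Rightarrow> real" where f: "mfd_Ck_on X 2 f UNIV"
    "\<And>x. hessian_pos_ge X (CARD('n) + 1 - p) f x"
    using assms(3) by blast
  have ne: "Psi X p A \<noteq> {}"
    by (rule Psi_nonempty[OF assms(2) f mfd_C2_continuous[OF assms(2) f(1)] assms(4,5)])
  moreover have "norm (u x) \<le> (SUP y\<in>Psi X p A. norm (u y))"
    if x: "x \<in> A" and cont: "continuous_on A u"
      and u: "u \<in> sections A (lacr_germs X A) (A - closure (Psi X p A))" for x u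
  proof -
    have "bounded ((\<lambda>y. norm (u y)) ` A)"
      by (intro compact_imp_bounded compact_continuous_image continuous_intros cont assms(4))
    \<comment> \<open>A real \<open>SUP\<close> is an upper bound only for a set that is bounded
      above; compactness of \<open>A\<close> provides this.\<close>
    then have "bdd_above ((\<lambda>y. norm (u y)) ` Psi X p A)"
      by (rule bdd_above_mono[OF bounded_imp_bdd_above]) (auto simp: Psi_def)
    then have up: "norm (u y) \<le> (SUP y\<in>Psi X p A. norm (u y))" if "y \<in> Psi X p A" for y
      using that by (rule cSUP_upper[rotated])
    \<comment> \<open>Nonemptiness enters here: the supremum dominates some norm.\<close>
    moreover have "0 \<le> (SUP y\<in>Psi X p A. norm (u y))"
      using ne up norm_ge_zero order_trans by blast
    ultimately show ?thesis
      using lacr_maximum_principle[OF assms(2) f assms(4) cont u _ _ x] by blast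
  qed
  ultimately show ?thesis by blast
qed

end
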